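(* Let $X$, $\mathcal{Y}$, $\mathcal{S}$, $\mathcal{F}$, $N$, $\alpha_{t,\ell}$, $w_{t,\ell}$, $T_{t,\ell}$ ($t\in\mathcal{S}$, $\ell\in\{1,\dots,N\}$), the weight $\eta$ and the weighted space $\mathcal{Y}_\eta$ be as in the context and satisfy all the assumptions listed there. For compact $K\subseteq X$ put $m_K=\inf_{x\in K}\eta(x)$. Then the following statements are equivalent. (1) The families $\{T_{t,1}\}_{t\in\mathcal{S}},\dots,\{T_{t,N}\}_{t\in\mathcal{S}}$ are $d\mathcal{F}$-semi-transitive on $\mathcal{Y}_\eta$. (2) For each $\varepsilon\in(0,1)$ and every compact subset $K$ of $X$ there exist some $F\in\mathcal{F}$ and a family $\{E_t\}_{t\in F}$ of Borel subsets of $K$ such that for all $t\in F$ $$\|\chi_{K\setminus E_t}\|_{\mathcal{Y}}<(4+2N)N\varepsilon,$$ $$\Bigl(\sup_{x\in E_t}(\eta\circ\alpha_{t,s})(x)\,w_{t,s}^{-1}(x)\Bigr)\cdot\Bigl(\sup_{x\in E_t}(\eta\circ\alpha_{t,\ell}^{-1})(x)\,(w_{t,\ell}\circ\alpha_{t,\ell}^{-1})(x)\Bigr)<\frac{m_K^2\varepsilon^2}{(1-\varepsilon)^2}$$ for all $\ell,s\in\{1,\dots,N\}$, and moreover, for all $t\in F$ and all distinct $s,\ell\in\{1,\dots,N\}$, $$\sup_{x\in E_t}\Biggl[(\eta\circ\alpha_{t,\ell}^{-1}\circ\alpha_{t,s})(x)\,\frac{(w_{t,\ell}\circ\alpha_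{t,\ell}^{-1}\circ\alpha_{t,s})(x)}{w_{t,s}(x)}\Biggr]<\frac{m_K\varepsilon}{1-\varepsilon}.$$
   Context: $X$ is a topological space and $\mathcal{M}_0(X)$ is the space of all Borel measurable (complex-valued) functions on $X$. A Banach function space on $X$ is a linear subspace $\mathcal{Y}$ of $\mathcal{M}_0(X)$ with a norm $\|\cdot\|_{\mathcal{Y}}$ making it a Banach space. It is solid if $f\in\mathcal{Y}$, $g\in\mathcal{M}_0(X)$, $|g|\le|f|$ imply $g\in\mathcal{Y}$ and $\|g\|_{\mathcal{Y}}\le\|f\|_{\mathcal{Y}}$. For a homeomorphism $\beta$ of $X$, $\mathcal{Y}$ is $\beta$-invariant if for all $f\in\mathcal{Y}$, $f\circ\beta^{\pm1}\in\mathcal{Y}$ and $\|f\circ\beta^{\pm1}\|_{\mathcal{Y}}=\|f\|_{\mathcal{Y}}$. Standing assumptions: - $\mathcal{Y}$ is a solid Banach function space on $X$; $\chi_K\in\mathcal{Y}$ for every compact $K\subseteq X$; and the set $\mathcal{Y}_{bc}$ of all bounded compactly supported functions in $\mathcal{Y}$ is dense in $\mathcal{Y}$. - $\mathcal{S}$ is a set, $\mathcal{F}$ a family of subsets of $\mathcal{S}$, $N\in\mathbb{N}$; for $t\in\mathcal{S}$, $\ell\in\{1,\dots,N\}$, $\alpha_{t,\ell}$ is a homeomorphism of $X$ and $\mathcal{Y}$ is $\alpha_{t,\ell}$-invariant. - The system is disjoint aperiodic: for every compact $K\subseteq X$ and every $H\in\mathcal{F}$ there is some $F\in\mathcal{F}$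 with $F\subseteq H$ such that for all $t\in F$, $K\cap\alpha_{t,\ell}(K)=\varnothing$ for all $\ell$, and $\alpha_{t,\ell}^{-1}(\alpha_{t,s}(K))\cap K=\varnothing$ for all distinct $s,\ell\in\{1,\dots,N\}$. - For $t\in\mathcal{S}$, $\ell\in\{1,\dots,N\}$, $w_{t,\ell}$ is a bounded positive measurable function on $X$ such that $w_{t,\ell}^{-1}:=1/w_{t,\ell}$ is bounded on compact subsets of $X$. - $\eta:X\to(0,\infty)$ is a weight with respect to every $\alpha_{t,\ell}$: it is continuous, and for each $t,\ell$ there is a constant $K_{t,\ell}>0$ with $\eta(\alpha_{t,\ell}(x))\le K_{t,\ell}\,\eta(x)$ and $\eta(\alpha_{t,\ell}^{-1}(x))\le K_{t,\ell}\,\eta(x)$ for all $x\in X$. The weighted space is $\mathcal{Y}_\eta=\{f\in\mathcal{M}_0(X): f\eta\in\mathcal{Y}\}$ with norm $\|f\|_{\mathcal{Y}_\eta}=\|f\eta\|_{\mathcal{Y}}$. The operators $T_{t,\ell}(f)=w_{t,\ell}\cdot(f\circ\alpha_{t,\ell})$ are bounded linear self-maps of $\mathcal{Y}_\eta$. Definition. Families $\{T_{t,1}\}_{t\in\mathcal{S}},\dots,\{T_{t,N}\}_{t\in\mathcal{S}}$ of bounded linear operators on a Banach space $Z$ are $d\mathcal{F}$-semi-transitive if for all non-empty open subsets $\mathcal{O},V_1,\dots,V_N$ of $Z$ there is some $F\in\mathcal{F}$ such that for every $t\in F$ there is a real $\lambda_t>0$ with $\mathcal{O}\cap\lambda_tT_{t,1}^{-1}(V_1)\cap\dots\cap\lambda_tT_{t,N}^{-1}(V_N)\neq\varnothing$,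 where $T_{t,\ell}^{-1}(V_\ell)$ denotes the preimage. Convention: the supremum of a non-negative function over the empty set is $0$. *)

theory Defs
  imports "HOL-Analysis.Analysis"
begin

section \<open>Banach function spaces\<close>

text \<open>
  The underlying space is a type of class \<open>topological_space\<close>; no separation
  or local compactness is assumed. A function space is a carrier set \<open>Y\<close> of genuine functions
  (not classes modulo null sets) together with a norm \<open>n\<close>, of which only
  the values on \<open>Y\<close> matter.
\<close>

text \<open>
  The locale \<open>Metric_space\<close> wants a distance that is non-negative and symmetric on the whole
  type, so the distance is set to \<open>0\<close> outside the carrier.
\<close>

definition fun_dist ::
    "('x \<Rightarrow> complex) set \<Rightarrow> (('x \<Rightarrow> complex) \<Rightarrow> real) \<Rightarrow> ('x \<Rightarrow> complex) \<Rightarrow> ('x \<Rightarrow> complex) \<Rightarrow> real"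
  where "fun_dist Y n f g = (if f \<in> Y \<and> g \<in> Y then n (\<lambda>x. f x - g x) else 0)"

abbreviation fun_topology :: "('x \<Rightarrow> complex) set \<Rightarrow> (('x \<Rightarrow> complex) \<Rightarrow> real) \<Rightarrow> ('x \<Rightarrow> complex) topology"
  where "fun_topology Y n \<equiv> Metric_space.mtopology Y (fun_dist Y n)"

definition linear_function_space :: "('x::topological_space \<Rightarrow> complex) set \<Rightarrow> bool"
  where "linear_function_space Y \<longleftrightarrow>
    Y \<subseteq> borel_measurable borel \<and>
    (\<lambda>x. 0) \<in> Y \<and>
    (\<forall>f\<in>Y. \<forall>g\<in>Y. (\<lambda>x. f x + g x) \<in> Y) \<and>
    (\<forall>c. \<forall>f\<in>Y. (\<lambda>x. c * f x) \<in> Y)"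

definition norm_on_fun :: "('x \<Rightarrow> complex) set \<Rightarrow> (('x \<Rightarrow> complex) \<Rightarrow> real) \<Rightarrow> bool"
  where "norm_on_fun Y n \<longleftrightarrow>
    (\<forall>f\<in>Y. 0 \<le> n f) \<and>
    (\<forall>f\<in>Y. n f = 0 \<longleftrightarrow> f = (\<lambda>x. 0)) \<and>
    (\<forall>f\<in>Y. \<forall>g\<in>Y. n (\<lambda>x. f x + g x) \<le> n f + n g) \<and>
    (\<forall>c. \<forall>f\<in>Y. n (\<lambda>x. c * f x) = cmod c * n f)"

definition banach_function_space ::
    "('x::topological_space \<Rightarrow> complex) set \<Rightarrow> (('x \<Rightarrow> complex) \<Rightarrow> real) \<Rightarrow> bool"
  where "banach_function_space Y n \<longleftrightarrow>
    linear_function_space Y \<and> norm_on_fun Y n \<and> Metric_space.mcomplete Y (fun_dist Y n)"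

lemma linear_function_spaceD:
  assumes "linear_function_space Y"
  shows "f \<in> Y \<Longrightarrow> g \<in> Y \<Longrightarrow> (\<lambda>x. f x + g x) \<in> Y"
    and "f \<in> Y \<Longrightarrow> (\<lambda>x. c * f x) \<in> Y"
  using assms unfolding linear_function_space_def by simp_all

lemma norm_on_funD:
  assumes "norm_on_fun Y n"
  shows "f \<in> Y \<Longrightarrow> 0 \<le> n f"
    and "f \<in> Y \<Longrightarrow> n f = 0 \<longleftrightarrow> f = (\<lambda>x. 0)"
    and "f \<in> Y \<Longrightarrow> g \<in> Y \<Longrightarrow> n (\<lambda>x. f x + g x) \<le> n f + n g"
    and "f \<in> Y \<Longrightarrow> n (\<lambda>x. c * f x) = cmod c * n f"
  using assms unfolding norm_on_fun_def by simp_all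

lemma Metric_space_fun_dist:
  assumes lin: "linear_function_space Y" and nrm: "norm_on_fun Y n"
  shows "Metric_space Y (fun_dist Y n)"
proof -
  have diff: "(\<lambda>x. f x - g x) \<in> Y" if "f \<in> Y" "g \<in> Y" for f g
    using linear_function_spaceD(1)[OF lin that(1) linear_function_spaceD(2)[OF lin that(2), of "-1"]]
    by simp
  show ?thesis
  proof
    fix f g
    show "0 \<le> fun_dist Y n f g"
      using norm_on_funD(1)[OF nrm diff[of f g]] by (simp add: fun_dist_def)
    show "fun_dist Y n f g = fun_dist Y n g f"
    proof (cases "f \<in> Y \<and> g \<in> Y")
      case True
      then show ?thesis
        using norm_on_funD(4)[OF nrm diff[of f g], of "-1"] by (simp add: fun_dist_def)
    qed (auto simp: fun_dist_def)
  next
    fix f g assume "f \<in> Y" "g \<in> Y"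
    then show "fun_dist Y n f g = 0 \<longleftrightarrow> f = g"
      using norm_on_funD(2)[OF nrm diff[of f g]] by (simp add: fun_dist_def fun_eq_iff)
  next
    fix f g h assume Y: "f \<in> Y" "g \<in> Y" "h \<in> Y"
    show "fun_dist Y n f h \<le> fun_dist Y n f g + fun_dist Y n g h"
      using norm_on_funD(3)[OF nrm diff[OF Y(1,2)] diff[OF Y(2,3)]] Y by (simp add: fun_dist_def)
  qed
qed

definition solid_space ::
    "('x::topological_space \<Rightarrow> complex) set \<Rightarrow> (('x \<Rightarrow> complex) \<Rightarrow> real) \<Rightarrow> bool"
  where "solid_space Y n \<longleftrightarrow>
    (\<forall>f\<in>Y. \<forall>g\<in>borel_measurable borel.
       (\<forall>x. cmod (g x) \<le> cmod (f x)) \<longrightarrow> g \<in> Y \<and> n g \<le> n f)"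

definition invariant_under ::
    "('x \<Rightarrow> 'x) \<Rightarrow> ('x \<Rightarrow> complex) set \<Rightarrow> (('x \<Rightarrow> complex) \<Rightarrow> real) \<Rightarrow> bool"
  where "invariant_under \<beta> Y n \<longleftrightarrow>
    (\<forall>f\<in>Y. f \<circ> \<beta> \<in> Y \<and> f \<circ> inv \<beta> \<in> Y \<and> n (f \<circ> \<beta>) = n f \<and> n (f \<circ> inv \<beta>) = n f)"

definition bounded_compact_support ::
    "('x::topological_space \<Rightarrow> complex) set \<Rightarrow> ('x \<Rightarrow> complex) set"
  where "bounded_compact_support Y =
    {f \<in> Y. bounded (range f) \<and> compact (closure {x. f x \<noteq> 0})}"

definition weighted_space ::
    "('x::topological_space \<Rightarrow> complex) set \<Rightarrow> ('x \<Rightarrow> real) \<Rightarrow> ('x \<Rightarrow> complex) set"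
  where "weighted_space Y \<eta> = {f \<in> borel_measurable borel. (\<lambda>x. f x * of_real (\<eta> x)) \<in> Y}"

definition weighted_norm ::
    "(('x \<Rightarrow> complex) \<Rightarrow> real) \<Rightarrow> ('x \<Rightarrow> real) \<Rightarrow> ('x \<Rightarrow> complex) \<Rightarrow> real"
  where "weighted_norm n \<eta> f = n (\<lambda>x. f x * of_real (\<eta> x))"


section \<open>The dynamical system, its weights and its operators\<close>

definition disjoint_aperiodic ::
    "'t set set \<Rightarrow> nat \<Rightarrow> ('t \<Rightarrow> nat \<Rightarrow> 'x::topological_space \<Rightarrow> 'x) \<Rightarrow> bool"
  where "disjoint_aperiodic \<F> N \<alpha> \<longleftrightarrow>
    (\<forall>K. \<forall>H\<in>\<F>. compact K \<longrightarrow>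
       (\<exists>F\<in>\<F>. F \<subseteq> H \<and>
          (\<forall>t\<in>F.
             (\<forall>l\<in>{1..N}. K \<inter> \<alpha> t l ` K = {}) \<and>
             (\<forall>s\<in>{1..N}. \<forall>l\<in>{1..N}. s \<noteq> l \<longrightarrow> inv (\<alpha> t l) ` (\<alpha> t s ` K) \<inter> K = {}))))"

definition weight_wrt :: "('x::topological_space \<Rightarrow> 'x) \<Rightarrow> ('x \<Rightarrow> real) \<Rightarrow> bool"
  where "weight_wrt \<beta> \<eta> \<longleftrightarrow>
    continuous_on UNIV \<eta> \<and> (\<forall>x. 0 < \<eta> x) \<and>
    (\<exists>C>0. \<forall>x. \<eta> (\<beta> x) \<le> C * \<eta> x \<and> \<eta> (inv \<beta> x) \<le> C * \<eta> x)"

definition weighted_comp :: "('x \<Rightarrow> real) \<Rightarrow> ('x \<Rightarrow> 'x) \<Rightarrow> ('x \<Rightarrow> complex) \<Rightarrow> ('x \<Rightarrow> complex)"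
  where "weighted_comp w \<beta> f = (\<lambda>x. of_real (w x) * f (\<beta> x))"

text \<open>
  The set comprehension is \<open>\<lambda>\<^sub>t T\<^sub>t\<^sub>,\<^sub>l\<^sup>-\<^sup>1(V\<^sub>l)\<close>, the scalar multiple by \<open>r = \<lambda>\<^sub>t\<close> of the
  preimage of \<open>V l\<close> in \<open>Z\<close>.
\<close>

definition dF_semi_transitive ::
    "'t set set \<Rightarrow> nat \<Rightarrow> ('x \<Rightarrow> complex) set \<Rightarrow> (('x \<Rightarrow> complex) \<Rightarrow> real) \<Rightarrow>
     ('t \<Rightarrow> nat \<Rightarrow> ('x \<Rightarrow> complex) \<Rightarrow> ('x \<Rightarrow> complex)) \<Rightarrow> bool"
  where "dF_semi_transitive \<F> N Z n T \<longleftrightarrow>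
    (\<forall>U V. openin (fun_topology Z n) U \<and> U \<noteq> {} \<and>
       (\<forall>l\<in>{1..N}. openin (fun_topology Z n) (V l) \<and> V l \<noteq> {}) \<longrightarrow>
       (\<exists>F\<in>\<F>. \<forall>t\<in>F. \<exists>r::real. 0 < r \<and>
          U \<inter> (\<Inter>l\<in>{1..N}. {(\<lambda>x. of_real r * f x) | f. f \<in> Z \<and> T t l f \<in> V l}) \<noteq> {}))"

text \<open>
  Suprema and infima of positive functions are taken in \<open>[0, \<infinity>]\<close>, so that the supremum over
  the empty set is \<open>0\<close> and the infimum over the empty set is \<open>\<infinity>\<close>.
\<close>

definition weight_inf :: "('x \<Rightarrow> real) \<Rightarrow> 'x set \<Rightarrow> ennreal"
  where "weight_inf \<eta> K = (INF x\<in>K. ennreal (\<eta> x))"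


section \<open>The operators are bounded linear self-maps of the weighted space\<close>

definition bounded_linear_selfmap ::
    "('x \<Rightarrow> complex) set \<Rightarrow> (('x \<Rightarrow> complex) \<Rightarrow> real) \<Rightarrow> (('x \<Rightarrow> complex) \<Rightarrow> ('x \<Rightarrow> complex)) \<Rightarrow> bool"
  where "bounded_linear_selfmap Z n T \<longleftrightarrow>
    (\<forall>f\<in>Z. T f \<in> Z) \<and>
    (\<forall>f\<in>Z. \<forall>g\<in>Z. T (\<lambda>x. f x + g x) = (\<lambda>x. T f x + T g x)) \<and>
    (\<forall>c. \<forall>f\<in>Z. T (\<lambda>x. c * f x) = (\<lambda>x. c * T f x)) \<and>
    (\<exists>C. \<forall>f\<in>Z. n (T f) \<le> C * n f)"

lemma weighted_comp_bounded_linear: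
  fixes \<beta> :: "'x::topological_space \<Rightarrow> 'x"
  assumes Y: "banach_function_space Y n" and solid: "solid_space Y n"
    and hom: "homeomorphism UNIV UNIV \<beta> (inv \<beta>)" and inv: "invariant_under \<beta> Y n"
    and w: "bounded (range w)" "\<And>x. 0 < w x" "w \<in> borel_measurable borel"
    and eta: "weight_wrt \<beta> \<eta>"
  shows "bounded_linear_selfmap (weighted_space Y \<eta>) (weighted_norm n \<eta>) (weighted_comp w \<beta>)"
proof -
  obtain B where B: "\<And>x. \<bar>w x\<bar> \<le> B"
    using w(1) by (auto simp: bounded_iff)
  obtain C where C: "C > 0" "\<And>x. \<eta> (inv \<beta> x) \<le> C * \<eta> x" and pos: "\<And>x. 0 < \<eta> x"
    and cont: "continuous_on UNIV \<eta>"
    using eta by (auto simp: weight_wrt_def)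
  have "0 \<le> B" using B[of undefined] by linarith
  have eta_le: "\<eta> x \<le> C * \<eta> (\<beta> x)" for x
    using C(2)[of "\<beta> x"] hom by (simp add: homeomorphism_def)
  have [measurable]: "\<eta> \<in> borel_measurable borel" "w \<in> borel_measurable borel"
    "\<beta> \<in> borel_measurable borel"
    using cont hom w(3) by (auto intro: borel_measurable_continuous_onI simp: homeomorphism_def)
  have key: "weighted_comp w \<beta> f \<in> weighted_space Y \<eta> \<and>
      weighted_norm n \<eta> (weighted_comp w \<beta> f) \<le> (B * C) * weighted_norm n \<eta> f"
    if f: "f \<in> weighted_space Y \<eta>" for f
  proof -
    define g where "g = (\<lambda>x. f x * of_real (\<eta> x))"
    have [measurable]: "f \<in> borel_measurable borel" and g: "g \<in> Y"
      using f by (auto simp: weighted_space_def g_def)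
    have gb: "g \<circ> \<beta> \<in> Y" "n (g \<circ> \<beta>) = n g"
      using inv g by (auto simp: invariant_under_def)
    define h where "h = (\<lambda>x. of_real (B * C) * (g \<circ> \<beta>) x)"
    have h: "h \<in> Y" "n h = (B * C) * n g"
    proof -
      show "h \<in> Y"
        unfolding h_def using Y gb(1) unfolding banach_function_space_def
        by (elim conjE) (rule linear_function_spaceD)
      have "n h = cmod (of_real (B * C)) * n (g \<circ> \<beta>)"
        unfolding h_def using Y gb(1) unfolding banach_function_space_def
        by (elim conjE) (rule norm_on_funD(4))
      then show "n h = (B * C) * n g"
        using gb(2) \<open>0 \<le> B\<close> C(1) by (simp add: norm_mult)
    qed
    have le: "cmod (weighted_comp w \<beta> f x * of_real (\<eta> x)) \<le> cmod (h x)" for x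
    proof -
      have "\<bar>w x\<bar> * \<eta> x \<le> B * (C * \<eta> (\<beta> x))"
        using B[of x] eta_le[of x] pos[of x] \<open>0 \<le> B\<close> by (intro mult_mono) auto
      then have "cmod (f (\<beta> x)) * (\<bar>w x\<bar> * \<eta> x) \<le> cmod (f (\<beta> x)) * (B * (C * \<eta> (\<beta> x)))"
        by (rule mult_left_mono) simp
      then show ?thesis
        using \<open>0 \<le> B\<close> C(1) pos[of x] pos[of "\<beta> x"]
        by (simp add: weighted_comp_def h_def g_def norm_mult mult_ac)
    qed
    have meas: "(\<lambda>x. weighted_comp w \<beta> f x * of_real (\<eta> x)) \<in> borel_measurable borel"
      "weighted_comp w \<beta> f \<in> borel_measurable borel"
      unfolding weighted_comp_def by measurable
    have "(\<lambda>x. weighted_comp w \<beta> f x * of_real (\<eta> x)) \<in> Y \<and>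
      n (\<lambda>x. weighted_comp w \<beta> f x * of_real (\<eta> x)) \<le> n h"
      using solid h(1) meas(1) le by (auto simp: solid_space_def)
    then show ?thesis
      using meas(2) h(2) by (simp add: weighted_space_def weighted_norm_def g_def)
  qed
  show ?thesis
    unfolding bounded_linear_selfmap_def
  proof (intro conjI ballI allI)
    show "\<exists>D. \<forall>f\<in>weighted_space Y \<eta>.
        weighted_norm n \<eta> (weighted_comp w \<beta> f) \<le> D * weighted_norm n \<eta> f"
      using key by blast
    show "weighted_comp w \<beta> f \<in> weighted_space Y \<eta>" if "f \<in> weighted_space Y \<eta>" for f
      using key that by blast
  qed (simp_all add: weighted_comp_def algebra_simps)
qed

end

theory Submission
  imports Defs
begin

text \<open>
  Why semi-transitivity gives the weight conditions. Apply it to small balls around the indicator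
  of \<open>K\<close>, once as \<open>\<O>\<close> and once as every \<open>V\<^sub>l\<close>: for each \<open>t\<close> there are \<open>f\<close> and \<open>\<rho> > 0\<close> such that
  \<open>f\<close> and all \<open>\<rho>\<^sup>-\<^sup>1 T\<^sub>l f\<close> are close to the indicator of \<open>K\<close>. By a Chebyshev inequality in the
  solid space, these functions are close to \<open>1\<close> at every point of \<open>K\<close> outside a set of small
  norm. Disjointness moves the points \<open>\<alpha>\<^sub>s x\<close>, \<open>\<alpha>\<^sub>l\<^sup>-\<^sup>1 x\<close> and \<open>\<alpha>\<^sub>l\<^sup>-\<^sup>1 \<alpha>\<^sub>s x\<close> with \<open>x\<close> in \<open>K\<close> out of
  \<open>K\<close>, so the same inequality, transported by the isometries \<open>u \<mapsto> u \<circ> \<alpha>\<^sub>s\<close> and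
  \<open>u \<mapsto> u \<circ> \<alpha>\<^sub>l\<^sup>-\<^sup>1\<close>, makes \<open>f\<close> and \<open>\<rho>\<^sup>-\<^sup>1 T\<^sub>l f\<close> small there. Each expression in the weight conditions is
  a quotient of a small value by a value close to \<open>1\<close>, up to a power of \<open>\<rho>\<close>: this power is \<open>\<rho>\<^sup>-\<^sup>1\<close>
  for the supremum over the points \<open>\<alpha>\<^sub>s x\<close> and \<open>\<rho>\<close> for the one over the points \<open>\<alpha>\<^sub>l\<^sup>-\<^sup>1 x\<close>, so it
  cancels in their product, and it is absent from the third supremum
  (lemma \<open>admissible_if_near_indicator\<close>).

  Why the weight conditions give semi-transitivity. By density, the given open sets contain bounded
  functions \<open>f\<close>, \<open>g\<^sub>1, \<dots>, g\<^sub>N\<close> that vanish off a common compact set \<open>K\<close>. With \<open>S\<^sub>l\<close> the right inverse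
  of \<open>T\<^sub>l\<close>, the function \<open>h = f \<chi>\<^sub>E + \<rho> \<Sum>\<^sub>l S\<^sub>l (g\<^sub>l \<chi>\<^sub>E)\<close> is close to \<open>f\<close>, and \<open>\<rho>\<^sup>-\<^sup>1 T\<^sub>l h\<close> is close
  to \<open>g\<^sub>l\<close>: cutting down from \<open>K\<close> to \<open>E\<close> costs little, and every cross term is a bounded function
  on \<open>E\<close>, transported by an isometry and multiplied by one of the weights in the conditions
  (lemma \<open>common_preimage\<close>). The products of suprema being small is exactly what allows one \<open>\<rho>\<close> to
  serve both for the terms carrying \<open>\<rho>\<close> and for those carrying \<open>\<rho>\<^sup>-\<^sup>1\<close> (lemma \<open>balancing_factor\<close>).
\<close>

section \<open>Solid function spaces\<close>

locale solid_function_space =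
  fixes Y :: "('x::topological_space \<Rightarrow> complex) set" and n :: "('x \<Rightarrow> complex) \<Rightarrow> real"
  assumes linear: "linear_function_space Y"
    and norm: "norm_on_fun Y n"
    and solid: "solid_space Y n"
begin

lemma measurable: "f \<in> Y \<Longrightarrow> f \<in> borel_measurable borel"
  using linear unfolding linear_function_space_def by blast

lemma zero: "(\<lambda>x. 0) \<in> Y"
  using linear unfolding linear_function_space_def by blast

lemma norm_nonneg: "f \<in> Y \<Longrightarrow> 0 \<le> n f"
  by (rule norm_on_funD(1)[OF norm])

lemma norm_zero: "n (\<lambda>x. 0) = 0"
  using norm_on_funD(2)[OF norm zero] by simp

lemma add:
  assumes "f \<in> Y" "g \<in> Y"
  shows "(\<lambda>x. f x + g x) \<in> Y" and "n (\<lambda>x. f x + g x) \<le> n f + n g"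
  using assms linear_function_spaceD(1)[OF linear] norm_on_funD(3)[OF norm] by auto

lemma scale:
  assumes "f \<in> Y"
  shows "(\<lambda>x. c * f x) \<in> Y" and "n (\<lambda>x. c * f x) = cmod c * n f"
  using assms linear_function_spaceD(2)[OF linear] norm_on_funD(4)[OF norm] by auto

lemma diff:
  assumes "f \<in> Y" "g \<in> Y"
  shows "(\<lambda>x. f x - g x) \<in> Y" and "n (\<lambda>x. f x - g x) \<le> n f + n g"
  using add[OF assms(1) scale(1)[OF assms(2), of "-1"]] scale(2)[OF assms(2), of "-1"]
  by simp_all

lemma sum:
  assumes "finite I" "\<And>i. i \<in> I \<Longrightarrow> \<phi> i \<in> Y" "\<And>i. i \<in> I \<Longrightarrow> n (\<phi> i) \<le> b"
  shows "(\<lambda>x. \<Sum>i\<in>I. \<phi> i x) \<in> Y \<and> n (\<lambda>x. \<Sum>i\<in>I. \<phi> i x) \<le> real (card I) * b"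
  using assms
proof (induction I rule: finite_induct)
  case empty
  then show ?case by (simp add: zero norm_zero)
next
  case (insert i I)
  then have IH: "(\<lambda>x. \<Sum>i\<in>I. \<phi> i x) \<in> Y" "n (\<lambda>x. \<Sum>i\<in>I. \<phi> i x) \<le> real (card I) * b"
    and i: "\<phi> i \<in> Y" "n (\<phi> i) \<le> b" by auto
  show ?case
    using add[OF i(1) IH(1)] IH(2) i(2) insert(1,2) by (simp add: algebra_simps)
qed

text \<open>Solidity with a constant, the form in which it enters all estimates below.\<close>

lemma dominated:
  assumes "u \<in> Y" "g \<in> borel_measurable borel" "0 \<le> c" "\<And>x. cmod (g x) \<le> c * cmod (u x)"
  shows "g \<in> Y" and "n g \<le> c * n u"
proof -
  have "\<forall>x. cmod (g x) \<le> cmod (of_real c * u x)"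
    using assms by (simp add: norm_mult)
  then have "g \<in> Y \<and> n g \<le> n (\<lambda>x. of_real c * u x)"
    using solid[unfolded solid_space_def, rule_format, OF scale(1)[OF assms(1)] assms(2)] by blast
  then show "g \<in> Y" "n g \<le> c * n u"
    unfolding scale(2)[OF assms(1), of "of_real c"] using assms(3) by simp_all
qed

lemma indicator_subset:
  assumes "indicator B \<in> Y" "A \<in> sets borel" "A \<subseteq> B"
  shows "indicator A \<in> Y"
proof (rule dominated(1)[OF assms(1), of _ 1])
  show "(indicator A :: 'x \<Rightarrow> complex) \<in> borel_measurable borel"
    using assms(2) by measurable
qed (use assms(3) in \<open>auto simp: indicator_def\<close>)

lemma borel_set:
  assumes "indicator K \<in> Y"
  shows "K \<in> sets borel"
  using measurable[OF assms] by (simp add: borel_measurable_indicator_iff)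

text \<open>
  A Chebyshev inequality for finitely many functions at once: on \<open>A\<close> the sum of their moduli is at
  least \<open>c\<close>, so it dominates \<open>c\<close> times the indicator.
\<close>

lemma chebyshev:
  assumes K: "indicator K \<in> Y" and "finite \<Phi>" and "0 < c"
    and \<Phi>: "\<And>\<phi>. \<phi> \<in> \<Phi> \<Longrightarrow> \<phi> \<in> Y" "\<And>\<phi>. \<phi> \<in> \<Phi> \<Longrightarrow> n \<phi> \<le> \<delta>"
    and A: "A \<in> sets borel" "\<And>x. x \<in> A \<Longrightarrow> \<exists>\<phi>\<in>\<Phi>. c \<le> cmod (\<phi> x)"
  shows "n (indicator A) \<le> real (card \<Phi>) * (\<delta> / c)"
proof -
  define u where "u \<phi> = (\<lambda>x. complex_of_real (cmod (\<phi> x)))" for \<phi> :: "'x \<Rightarrow> complex"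
  have u: "u \<phi> \<in> Y" "n (u \<phi>) \<le> \<delta>" if "\<phi> \<in> \<Phi>" for \<phi>
  proof -
    have m: "u \<phi> \<in> borel_measurable borel"
      using measurable[OF \<Phi>(1)[OF that]] unfolding u_def by measurable
    show "u \<phi> \<in> Y" "n (u \<phi>) \<le> \<delta>"
      using dominated[OF \<Phi>(1)[OF that] m, of 1] \<Phi>(2)[OF that] by (auto simp: u_def)
  qed
  let ?v = "\<lambda>x. \<Sum>\<phi>\<in>\<Phi>. u \<phi> x"
  have v: "?v \<in> Y" "n ?v \<le> real (card \<Phi>) * \<delta>"
    using sum[of \<Phi> u \<delta>] u assms(2) by auto
  have "n (indicator A) \<le> 1 / c * n ?v"
  proof (rule dominated(2)[OF v(1)])
    fix x
    have eq: "?v x = of_real (\<Sum>\<phi>\<in>\<Phi>. cmod (\<phi> x))"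
      by (simp add: u_def)
    have ge: "0 \<le> (\<Sum>\<phi>\<in>\<Phi>. cmod (\<phi> x))"
      by (simp add: sum_nonneg)
    have "c \<le> (\<Sum>\<phi>\<in>\<Phi>. cmod (\<phi> x))" if x: "x \<in> A"
    proof -
      obtain \<psi> where "\<psi> \<in> \<Phi>" "c \<le> cmod (\<psi> x)" using A(2)[OF x] by blast
      then show ?thesis
        using member_le_sum[of \<psi> \<Phi> "\<lambda>\<phi>. cmod (\<phi> x)"] assms(2) by auto
    qed
    then show "cmod (indicator A x) \<le> 1 / c * cmod (?v x)"
      unfolding eq norm_of_real using ge \<open>0 < c\<close> by (auto simp: indicator_def field_simps)
  qed (use A(1) \<open>0 < c\<close> in auto)
  also have "\<dots> \<le> 1 / c * (real (card \<Phi>) * \<delta>)"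
    using v(2) \<open>0 < c\<close> by (intro mult_left_mono) auto
  finally show ?thesis by simp
qed

lemma mball_eq:
  assumes "f \<in> Y"
  shows "Metric_space.mball Y (fun_dist Y n) f r = {h\<in>Y. n (\<lambda>x. h x - f x) < r}"
proof -
  interpret M: Metric_space Y "fun_dist Y n"
    by (rule Metric_space_fun_dist[OF linear norm])
  show ?thesis
    using assms unfolding M.mball_def by (subst M.commute) (auto simp: fun_dist_def)
qed

lemma openin_iff:
  "openin (fun_topology Y n) U \<longleftrightarrow>
    U \<subseteq> Y \<and> (\<forall>f\<in>U. \<exists>r>0. \<forall>h\<in>Y. n (\<lambda>x. h x - f x) < r \<longrightarrow> h \<in> U)"
proof -
  interpret M: Metric_space Y "fun_dist Y n"
    by (rule Metric_space_fun_dist[OF linear norm])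
  have "(\<exists>r>0. M.mball f r \<subseteq> U) \<longleftrightarrow> (\<exists>r>0. \<forall>h\<in>Y. n (\<lambda>x. h x - f x) < r \<longrightarrow> h \<in> U)"
    if "f \<in> Y" for f
    using that by (auto simp: mball_eq subset_eq)
  then show ?thesis
    unfolding M.openin_mtopology by (meson subsetD)
qed

lemma openin_ball:
  assumes f: "f \<in> Y"
  shows "openin (fun_topology Y n) {h\<in>Y. n (\<lambda>x. h x - f x) < r}"
proof -
  interpret M: Metric_space Y "fun_dist Y n"
    by (rule Metric_space_fun_dist[OF linear norm])
  show ?thesis using M.openin_mball[of f r] by (simp add: mball_eq[OF f])
qed

lemma dense_approx:
  assumes "fun_topology Y n closure_of D = Y" "f \<in> Y" "0 < r"
  obtains g where "g \<in> D" "g \<in> Y" "n (\<lambda>x. g x - f x) < r"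
proof -
  let ?U = "{h\<in>Y. n (\<lambda>x. h x - f x) < r}"
  have f: "f \<in> ?U"
    using assms norm_zero by simp
  have "f \<in> fun_topology Y n closure_of D"
    using assms by simp
  then obtain g where "g \<in> D" "g \<in> ?U"
    unfolding in_closure_of using f openin_ball[OF assms(2), of r] by meson
  then show thesis using that by simp
qed

end

section \<open>Weighted function spaces\<close>

text \<open>
  The map \<open>f \<mapsto> f \<eta>\<close> is linear, respects the pointwise order of moduli and, since \<open>\<eta>\<close> has no zero, is
  injective; so it pulls the structure of \<open>Y\<close> back.
\<close>

lemma solid_function_space_weighted:
  assumes "solid_function_space Y n" and [measurable]: "\<eta> \<in> borel_measurable borel"
    and pos: "\<And>x. 0 < \<eta> x"
  shows "solid_function_space (weighted_space Y \<eta>) (weighted_norm n \<eta>)"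
proof -
  interpret solid_function_space Y n by fact
  show ?thesis
  proof
    have e: "(f x + g x) * of_real (\<eta> x) = f x * of_real (\<eta> x) + g x * of_real (\<eta> x)"
      for f g :: "_ \<Rightarrow> complex" and x by (simp add: algebra_simps)
    show "linear_function_space (weighted_space Y \<eta>)"
      unfolding linear_function_space_def weighted_space_def
      by (auto simp: zero e mult.assoc intro: add scale)
    show "norm_on_fun (weighted_space Y \<eta>) (weighted_norm n \<eta>)"
      unfolding norm_on_fun_def
    proof (intro conjI ballI allI)
      fix f assume f: "f \<in> weighted_space Y \<eta>"
      then have fY: "(\<lambda>x. f x * of_real (\<eta> x)) \<in> Y" by (simp add: weighted_space_def)
      show "0 \<le> weighted_norm n \<eta> f"
        unfolding weighted_norm_def by (rule norm_nonneg[OF fY])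
      have "\<eta> x \<noteq> 0" for x using pos[of x] by simp
      then show "(weighted_norm n \<eta> f = 0) = (f = (\<lambda>x. 0))"
        unfolding weighted_norm_def norm_on_funD(2)[OF norm fY] by (auto simp: fun_eq_iff)
      show "weighted_norm n \<eta> (\<lambda>x. c * f x) = cmod c * weighted_norm n \<eta> f" for c
        unfolding weighted_norm_def using scale(2)[OF fY, of c] by (simp add: mult.assoc)
      fix g assume "g \<in> weighted_space Y \<eta>"
      then have gY: "(\<lambda>x. g x * of_real (\<eta> x)) \<in> Y" by (simp add: weighted_space_def)
      show "weighted_norm n \<eta> (\<lambda>x. f x + g x) \<le> weighted_norm n \<eta> f + weighted_norm n \<eta> g"
        unfolding weighted_norm_def e by (rule add(2)[OF fY gY])
    qed
    show "solid_space (weighted_space Y \<eta>) (weighted_norm n \<eta>)"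
      unfolding solid_space_def
    proof (intro ballI impI)
      fix f g assume f: "f \<in> weighted_space Y \<eta>" and [measurable]: "g \<in> borel_measurable borel"
        and le: "\<forall>x. cmod (g x) \<le> cmod (f x)"
      from f have fY: "(\<lambda>x. f x * of_real (\<eta> x)) \<in> Y" by (simp add: weighted_space_def)
      have m: "(\<lambda>x. g x * of_real (\<eta> x)) \<in> borel_measurable borel" by measurable
      have "cmod (g x * of_real (\<eta> x)) \<le> 1 * cmod (f x * of_real (\<eta> x))" for x
        using le by (simp add: norm_mult mult_right_mono)
      from dominated[OF fY m _ this]
      show "g \<in> weighted_space Y \<eta> \<and> weighted_norm n \<eta> g \<le> weighted_norm n \<eta> f"
        by (simp add: weighted_space_def weighted_norm_def)
    qed
  qed
qed

lemma weight_inf_attained: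
  assumes "continuous_on UNIV \<eta>" "compact K" "K \<noteq> {}"
  obtains x0 where "x0 \<in> K" "\<And>x. x \<in> K \<Longrightarrow> \<eta> x0 \<le> \<eta> x" "weight_inf \<eta> K = ennreal (\<eta> x0)"
proof -
  obtain x0 where x0: "x0 \<in> K" "\<forall>x\<in>K. \<eta> x0 \<le> \<eta> x"
    using continuous_attains_inf[OF assms(2,3) continuous_on_subset[OF assms(1)]] by auto
  have "weight_inf \<eta> K = ennreal (\<eta> x0)"
    unfolding weight_inf_def
    by (rule antisym) (use x0 in \<open>auto intro!: INF_lower INF_greatest ennreal_leI\<close>)
  then show thesis using that x0 by blast
qed

locale weighted_function_space = solid_function_space Y n
  for Y :: "('x::topological_space \<Rightarrow> complex) set" and n :: "('x \<Rightarrow> complex) \<Rightarrow> real" +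
  fixes \<eta> :: "'x \<Rightarrow> real"
  assumes weight_cont: "continuous_on UNIV \<eta>" and weight_pos: "\<And>x. 0 < \<eta> x"
begin

lemma weight_measurable: "\<eta> \<in> borel_measurable borel"
  by (rule borel_measurable_continuous_onI[OF weight_cont])

sublocale weighted: solid_function_space "weighted_space Y \<eta>" "weighted_norm n \<eta>"
  by (rule solid_function_space_weighted[OF solid_function_space_axioms weight_measurable weight_pos])

lemma weighted_dominated:
  assumes "u \<in> Y" "v \<in> borel_measurable borel" "0 \<le> c" "\<And>x. cmod (v x) * \<eta> x \<le> c * cmod (u x)"
  shows "v \<in> weighted_space Y \<eta>" and "weighted_norm n \<eta> v \<le> c * n u"
proof -
  have m: "(\<lambda>x. v x * of_real (\<eta> x)) \<in> borel_measurable borel"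
    using assms(2) weight_measurable by measurable
  have "cmod (v x * of_real (\<eta> x)) \<le> c * cmod (u x)" for x
    using assms(4)[of x] weight_pos[of x] by (simp add: norm_mult)
  from dominated[OF assms(1) m assms(3) this]
  show "v \<in> weighted_space Y \<eta>" "weighted_norm n \<eta> v \<le> c * n u"
    using assms(2) by (simp_all add: weighted_space_def weighted_norm_def)
qed

lemma weight_bounded:
  assumes "compact K"
  obtains M where "0 \<le> M" "\<And>x. x \<in> K \<Longrightarrow> \<eta> x \<le> M"
proof -
  have "bounded (\<eta> ` K)"
    by (intro compact_imp_bounded compact_continuous_image continuous_on_subset[OF weight_cont] assms) simp
  then obtain M where M: "\<And>x. x \<in> K \<Longrightarrow> \<bar>\<eta> x\<bar> \<le> M"
    by (auto simp: bounded_iff)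
  show thesis
    by (rule that[of "\<bar>M\<bar>"]) (use M in force)+
qed

lemma compact_indicator_weighted:
  assumes "compact K" "indicator K \<in> Y"
  shows "indicator K \<in> weighted_space Y \<eta>"
proof -
  obtain M where M: "0 \<le> M" "\<And>x. x \<in> K \<Longrightarrow> \<eta> x \<le> M"
    using weight_bounded[OF assms(1)] by blast
  show ?thesis
    by (rule weighted_dominated(1)[OF assms(2) measurable[OF assms(2)] M(1)])
      (use M in \<open>auto simp: indicator_def\<close>)
qed

text \<open>
  Approximate \<open>f \<eta>\<close> in \<open>Y\<close> by a bounded function with compact support and divide by \<open>\<eta>\<close>; the quotient
  stays bounded because \<open>\<eta>\<close> has a positive minimum on compact sets.
\<close>

lemma bounded_compact_in_open:
  assumes dense: "fun_topology Y n closure_of bounded_compact_support Y = Y"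
    and U: "openin (fun_topology (weighted_space Y \<eta>) (weighted_norm n \<eta>)) U" "U \<noteq> {}"
  shows "\<exists>f K B r. f \<in> borel_measurable borel \<and> (\<forall>x. cmod (f x) \<le> B) \<and> compact K \<and>
    (\<forall>x. x \<notin> K \<longrightarrow> f x = 0) \<and> 0 < r \<and>
    (\<forall>h\<in>weighted_space Y \<eta>. weighted_norm n \<eta> (\<lambda>x. h x - f x) < r \<longrightarrow> h \<in> U)"
proof -
  obtain f0 where f0: "f0 \<in> U" using U(2) by blast
  then obtain r0 where r0: "0 < r0"
      "\<And>h. h \<in> weighted_space Y \<eta> \<Longrightarrow> weighted_norm n \<eta> (\<lambda>x. h x - f0 x) < r0 \<Longrightarrow> h \<in> U"
    and f0Z: "f0 \<in> weighted_space Y \<eta>"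
    using U(1) unfolding weighted.openin_iff by blast
  have f0Y: "(\<lambda>x. f0 x * of_real (\<eta> x)) \<in> Y" using f0Z by (simp add: weighted_space_def)
  obtain g where g: "g \<in> bounded_compact_support Y" "g \<in> Y" "n (\<lambda>x. g x - f0 x * of_real (\<eta> x)) < r0"
    by (rule dense_approx[OF dense f0Y r0(1)])
  define f where "f = (\<lambda>x. g x / of_real (\<eta> x))"
  \<comment> \<open>The extra point only ensures that \<open>\<eta>\<close> attains its minimum on \<open>K\<close>.\<close>
  define K where "K = insert undefined (closure {x. g x \<noteq> 0})"
  have eta: "\<eta> x \<noteq> 0" for x using weight_pos[of x] by simp
  have fg: "(\<lambda>x. f x * of_real (\<eta> x)) = g" using eta by (simp add: f_def)
  have fm: "f \<in> borel_measurable borel"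
    unfolding f_def using measurable[OF g(2)] weight_measurable by measurable
  have fZ: "f \<in> weighted_space Y \<eta>" using fm g(2) by (simp add: weighted_space_def fg)
  have "weighted_norm n \<eta> (\<lambda>x. f x - f0 x) = n (\<lambda>x. g x - f0 x * of_real (\<eta> x))"
    unfolding weighted_norm_def by (simp add: left_diff_distrib fun_cong[OF fg])
  then have fU: "f \<in> U" using r0(2)[OF fZ] g(3) by simp
  have cK: "compact K"
    using g(1) by (simp add: K_def bounded_compact_support_def)
  have f_off: "f x = 0" if "x \<notin> K" for x
    using that closure_subset[of "{x. g x \<noteq> 0}"] by (auto simp: K_def f_def)
  obtain b where b: "\<And>x. cmod (g x) \<le> b"
    using g(1) by (auto simp: bounded_compact_support_def bounded_iff)
  obtain x0 where x0: "x0 \<in> K" "\<And>x. x \<in> K \<Longrightarrow> \<eta> x0 \<le> \<eta> x"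
    by (rule weight_inf_attained[OF weight_cont cK]) (auto simp: K_def)
  have "cmod (f x) \<le> b / \<eta> x0" for x
  proof (cases "x \<in> K")
    case True
    have "cmod (g x) / \<eta> x \<le> b / \<eta> x0"
      using b[of x] x0(2)[OF True] weight_pos[of x0] norm_ge_zero[of "g x"] by (intro frac_le) linarith+
    then show ?thesis using weight_pos[of x] by (simp add: f_def norm_divide)
  next
    case False
    have "0 \<le> b" using b[of x] norm_ge_zero order_trans by blast
    then show ?thesis using f_off[OF False] weight_pos[of x0] by simp
  qed
  moreover obtain r where "0 < r" "\<forall>h\<in>weighted_space Y \<eta>. weighted_norm n \<eta> (\<lambda>x. h x - f x) < r \<longrightarrow> h \<in> U"
    using U(1) fU unfolding weighted.openin_iff by blast
  ultimately show ?thesis using fm cK f_off by blast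
qed

lemma bounded_compact_in_opens:
  fixes W :: "'i \<Rightarrow> ('x \<Rightarrow> complex) set"
  assumes dense: "fun_topology Y n closure_of bounded_compact_support Y = Y"
    and I: "finite I" "I \<noteq> {}"
    and W: "\<And>l. l \<in> I \<Longrightarrow> openin (fun_topology (weighted_space Y \<eta>) (weighted_norm n \<eta>)) (W l)"
      "\<And>l. l \<in> I \<Longrightarrow> W l \<noteq> {}"
  obtains f :: "'i \<Rightarrow> 'x \<Rightarrow> complex" and K B r where
    "\<forall>l\<in>I. f l \<in> borel_measurable borel" "\<forall>l\<in>I. \<forall>x. cmod (f l x) \<le> B"
    "compact K" "K \<noteq> {}" "\<forall>l\<in>I. \<forall>x. x \<notin> K \<longrightarrow> f l x = 0" "0 \<le> B" "0 < r"
    "\<forall>l\<in>I. \<forall>h\<in>weighted_space Y \<eta>. weighted_norm n \<eta> (\<lambda>x. h x - f l x) < r \<longrightarrow> h \<in> W l"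
proof -
  let ?Z = "weighted_space Y \<eta>" and ?n = "weighted_norm n \<eta>"
  let ?P = "\<lambda>l f L b \<rho>. f \<in> borel_measurable borel \<and> (\<forall>x. cmod (f x) \<le> b) \<and> compact L \<and>
    (\<forall>x. x \<notin> L \<longrightarrow> f x = 0) \<and> 0 < \<rho> \<and> (\<forall>h\<in>?Z. ?n (\<lambda>x. h x - f x) < \<rho> \<longrightarrow> h \<in> W l)"
  have "\<forall>l\<in>I. \<exists>f L b \<rho>. ?P l f L b \<rho>"
    using bounded_compact_in_open[OF dense W] by (rule ballI)
  then obtain f where "\<forall>l\<in>I. \<exists>L b \<rho>. ?P l (f l) L b \<rho>" by (rule bchoice[THEN exE])
  then obtain L where "\<forall>l\<in>I. \<exists>b \<rho>. ?P l (f l) (L l) b \<rho>" by (rule bchoice[THEN exE])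
  then obtain b where "\<forall>l\<in>I. \<exists>\<rho>. ?P l (f l) (L l) (b l) \<rho>" by (rule bchoice[THEN exE])
  then obtain \<rho> where "\<forall>l\<in>I. ?P l (f l) (L l) (b l) (\<rho> l)" by (rule bchoice[THEN exE])
  then have f: "f l \<in> borel_measurable borel" "\<And>x. cmod (f l x) \<le> b l" "compact (L l)"
      "\<And>x. x \<notin> L l \<Longrightarrow> f l x = 0" "0 < \<rho> l"
      "\<And>h. h \<in> ?Z \<Longrightarrow> ?n (\<lambda>x. h x - f l x) < \<rho> l \<Longrightarrow> h \<in> W l" if "l \<in> I" for l
    using that by auto
  \<comment> \<open>The extra point makes \<open>K\<close> non-empty, so that the infimum of \<open>\<eta>\<close> over \<open>K\<close> is finite.\<close>
  define K where "K = insert undefined (\<Union>l\<in>I. L l)"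
  define B where "B = (\<Sum>l\<in>I. \<bar>b l\<bar>)"
  define r where "r = Min (\<rho> ` I)"
  have K: "compact K" "K \<noteq> {}"
    unfolding K_def by (intro compact_insert compact_UN f(3) I) simp_all
  have B: "0 \<le> B" "\<And>l x. l \<in> I \<Longrightarrow> cmod (f l x) \<le> B"
  proof -
    show "0 \<le> B" unfolding B_def by (simp add: sum_nonneg)
    show "cmod (f l x) \<le> B" if l: "l \<in> I" for l x
      using f(2)[OF l, of x] member_le_sum[OF l, of "\<lambda>l. \<bar>b l\<bar>"] I by (simp add: B_def)
  qed
  have f0: "f l x = 0" if "l \<in> I" "x \<notin> K" for l x
    using f(4)[OF that(1)] that by (auto simp: K_def)
  have r: "0 < r" "\<And>l. l \<in> I \<Longrightarrow> r \<le> \<rho> l"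
    unfolding r_def using I by (simp_all add: f(5))
  show thesis
  proof (rule that[of f B K r])
    show "\<forall>l\<in>I. \<forall>h\<in>?Z. ?n (\<lambda>x. h x - f l x) < r \<longrightarrow> h \<in> W l"
      using f(6) r(2) by (meson order_less_le_trans)
  qed (simp_all add: f(1) B K f0 r(1))
qed

end

section \<open>Weighted translation operators for one parameter\<close>

text \<open>
  One factor \<open>\<rho>\<close> must lie above all \<open>b l y / \<tau>\<close> and below all \<open>\<tau> / a s x\<close>. Since \<open>a s x * b l y \<le> \<tau>\<^sup>2\<close>,
  every number of the first kind lies below every number of the second kind, and the supremum of
  the former does it.
\<close>

lemma balancing_factor:
  fixes a b :: "'i \<Rightarrow> 'x \<Rightarrow> real"
  assumes "i0 \<in> I" and \<tau>: "0 < \<tau>"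
    and a: "\<And>s x. s \<in> I \<Longrightarrow> x \<in> E \<Longrightarrow> 0 < a s x" and b: "\<And>l x. l \<in> I \<Longrightarrow> x \<in> E \<Longrightarrow> 0 < b l x"
    and ab: "\<And>l s x y. l \<in> I \<Longrightarrow> s \<in> I \<Longrightarrow> x \<in> E \<Longrightarrow> y \<in> E \<Longrightarrow> a s x * b l y \<le> \<tau>\<^sup>2"
  obtains \<rho> where "0 < \<rho>" "\<forall>s\<in>I. \<forall>x\<in>E. \<rho> * a s x \<le> \<tau>"
    "\<forall>l\<in>I. \<forall>x\<in>E. b l x \<le> \<tau> * \<rho>"
proof (cases "E = {}")
  case True
  then show thesis using that[of 1] by simp
next
  case False
  then obtain x0 where x0: "x0 \<in> E" by blast
  let ?\<beta> = "\<lambda>(l, y). b l y / \<tau>"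
  define \<rho> where "\<rho> = (SUP z\<in>I \<times> E. ?\<beta> z)"
  have below: "?\<beta> z \<le> \<tau> / a s x" if "z \<in> I \<times> E" "s \<in> I" "x \<in> E" for z s x
    using ab[of "fst z" s x "snd z"] that a[OF that(2,3)] \<tau>
    by (auto simp: field_simps power2_eq_square)
  have upper: "?\<beta> z \<le> \<rho>" if "z \<in> I \<times> E" for z
    unfolding \<rho>_def
    by (rule cSUP_upper[OF that]) (use below[OF _ assms(1) x0] in \<open>auto intro!: bdd_aboveI2\<close>)
  show thesis
  proof (intro that ballI)
    have "0 < b i0 x0 / \<tau>" using b[OF assms(1) x0] \<tau> by simp
    then show "0 < \<rho>" using upper[of "(i0, x0)"] assms(1) x0 by simp
    show "\<rho> * a s x \<le> \<tau>" if "s \<in> I" "x \<in> E" for s x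
    proof -
      have "\<rho> \<le> \<tau> / a s x"
        unfolding \<rho>_def by (rule cSUP_least) (use assms(1) x0 below that in auto)
      then show ?thesis using a[OF that] by (simp add: pos_le_divide_eq)
    qed
    show "b l x \<le> \<tau> * \<rho>" if "l \<in> I" "x \<in> E" for l x
      using upper[of "(l, x)"] that \<tau> by (simp add: pos_divide_le_eq mult.commute)
  qed
qed

locale weighted_translations = weighted_function_space Y n \<eta>
  for Y :: "('x::topological_space \<Rightarrow> complex) set" and n :: "('x \<Rightarrow> complex) \<Rightarrow> real"
    and \<eta> :: "'x \<Rightarrow> real" +
  fixes N :: nat and \<alpha> :: "nat \<Rightarrow> 'x \<Rightarrow> 'x" and w :: "nat \<Rightarrow> 'x \<Rightarrow> real"
  assumes hom: "\<And>l. l \<in> {1..N} \<Longrightarrow> homeomorphism UNIV UNIV (\<alpha> l) (inv (\<alpha> l))"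
    and invariant: "\<And>l. l \<in> {1..N} \<Longrightarrow> invariant_under (\<alpha> l) Y n"
    and w_measurable: "\<And>l. l \<in> {1..N} \<Longrightarrow> w l \<in> borel_measurable borel"
    and w_pos: "\<And>l x. l \<in> {1..N} \<Longrightarrow> 0 < w l x"
begin

lemma translation_inverse [simp]:
  assumes "l \<in> {1..N}"
  shows "\<alpha> l (inv (\<alpha> l) x) = x" and "inv (\<alpha> l) (\<alpha> l x) = x"
  using hom[OF assms] by (auto simp: homeomorphism_def)

lemma translation_measurable:
  assumes "l \<in> {1..N}"
  shows "\<alpha> l \<in> borel_measurable borel" and "inv (\<alpha> l) \<in> borel_measurable borel"
  using hom[OF assms] by (auto intro: borel_measurable_continuous_onI simp: homeomorphism_def)

lemma translate:
  assumes "u \<in> Y" "l \<in> {1..N}"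
  shows "u \<circ> \<alpha> l \<in> Y" "n (u \<circ> \<alpha> l) = n u" "u \<circ> inv (\<alpha> l) \<in> Y" "n (u \<circ> inv (\<alpha> l)) = n u"
  using invariant[OF assms(2)] assms(1) unfolding invariant_under_def by auto

text \<open>
  What the characterisation demands of \<open>E\<^sub>t\<close> for a single \<open>t\<close>. The parameter \<open>t\<close> is fixed in this
  context and does not appear.
\<close>

definition admissible :: "real \<Rightarrow> 'x set \<Rightarrow> 'x set \<Rightarrow> bool"
  where "admissible \<epsilon> K E \<longleftrightarrow> E \<in> sets borel \<and> E \<subseteq> K \<and>
     n (indicator (K - E)) < (4 + 2 * real N) * real N * \<epsilon> \<and>
     (\<forall>l\<in>{1..N}. \<forall>s\<in>{1..N}.
        (SUP x\<in>E. ennreal (\<eta> (\<alpha> s x) * (1 / w s x))) *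
        (SUP x\<in>E. ennreal (\<eta> (inv (\<alpha> l) x) * w l (inv (\<alpha> l) x)))
        < (weight_inf \<eta> K)\<^sup>2 * ennreal (\<epsilon>\<^sup>2 / (1 - \<epsilon>)\<^sup>2)) \<and>
     (\<forall>s\<in>{1..N}. \<forall>l\<in>{1..N}. s \<noteq> l \<longrightarrow>
        (SUP x\<in>E. ennreal (\<eta> (inv (\<alpha> l) (\<alpha> s x)) *
           (w l (inv (\<alpha> l) (\<alpha> s x)) / w s x)))
        < weight_inf \<eta> K * ennreal (\<epsilon> / (1 - \<epsilon>)))"

lemma weight_bound_squared:
  assumes "weight_inf \<eta> K = ennreal m" "0 < m"
  shows "(weight_inf \<eta> K)\<^sup>2 * ennreal (\<epsilon>\<^sup>2 / (1 - \<epsilon>)\<^sup>2) = ennreal ((m * (\<epsilon> / (1 - \<epsilon>)))\<^sup>2)"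
  using assms by (simp add: ennreal_power power_mult_distrib power_divide flip: ennreal_mult')

text \<open>The bounds may contain an arbitrary \<open>\<rho>\<close>, as it cancels in the product of the two suprema.\<close>

lemma admissibleI:
  assumes E: "E \<in> sets borel" "E \<subseteq> K" "n (indicator (K - E)) < (4 + 2 * real N) * real N * \<epsilon>"
    and m: "weight_inf \<eta> K = ennreal m" "0 < m" and \<epsilon>: "0 < \<epsilon>" "\<epsilon> < 1"
    and c: "0 < c" "c < m * \<epsilon>" and r: "0 < \<rho>"
    and P: "\<And>s x. s \<in> {1..N} \<Longrightarrow> x \<in> E \<Longrightarrow> \<eta> (\<alpha> s x) * (1 / w s x) \<le> c / (1 - \<epsilon>) / \<rho>"
    and Q: "\<And>l x. l \<in> {1..N} \<Longrightarrow> x \<in> E \<Longrightarrow>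
       \<eta> (inv (\<alpha> l) x) * w l (inv (\<alpha> l) x) \<le> c / (1 - \<epsilon>) * \<rho>"
    and R: "\<And>s l x. s \<in> {1..N} \<Longrightarrow> l \<in> {1..N} \<Longrightarrow> s \<noteq> l \<Longrightarrow> x \<in> E \<Longrightarrow>
       \<eta> (inv (\<alpha> l) (\<alpha> s x)) * (w l (inv (\<alpha> l) (\<alpha> s x)) / w s x) \<le> c / (1 - \<epsilon>)"
  shows "admissible \<epsilon> K E"
proof -
  let ?c = "c / (1 - \<epsilon>)"
  have c1: "0 < ?c" "?c < m * (\<epsilon> / (1 - \<epsilon>))" using c \<epsilon> by (simp_all add: divide_strict_right_mono)
  show ?thesis
    unfolding admissible_def
  proof (intro conjI ballI impI)
    fix s l assume s: "s \<in> {1..N}" and l: "l \<in> {1..N}"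
    have "(SUP x\<in>E. ennreal (\<eta> (\<alpha> s x) * (1 / w s x))) *
        (SUP x\<in>E. ennreal (\<eta> (inv (\<alpha> l) x) * w l (inv (\<alpha> l) x)))
      \<le> ennreal (?c / \<rho>) * ennreal (?c * \<rho>)"
    proof (rule mult_mono)
      show "(SUP x\<in>E. ennreal (\<eta> (\<alpha> s x) * (1 / w s x))) \<le> ennreal (?c / \<rho>)"
        by (intro SUP_least ennreal_leI) (use P s in blast)
      show "(SUP x\<in>E. ennreal (\<eta> (inv (\<alpha> l) x) * w l (inv (\<alpha> l) x))) \<le> ennreal (?c * \<rho>)"
        by (intro SUP_least ennreal_leI) (use Q l in blast)
    qed simp_all
    also have "\<dots> = ennreal (?c / \<rho> * (?c * \<rho>))"
      by (rule ennreal_mult'[symmetric]) (use c1(1) r in \<open>simp only: divide_nonneg_pos less_imp_le\<close>)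
    also have "?c / \<rho> * (?c * \<rho>) = ?c\<^sup>2"
      using r by (simp add: power2_eq_square)
    also have "\<dots> < ennreal ((m * (\<epsilon> / (1 - \<epsilon>)))\<^sup>2)"
      using c1 by (intro ennreal_lessI power_strict_mono zero_less_power) auto
    also note weight_bound_squared[OF m, symmetric]
    finally show "(SUP x\<in>E. ennreal (\<eta> (\<alpha> s x) * (1 / w s x))) *
        (SUP x\<in>E. ennreal (\<eta> (inv (\<alpha> l) x) * w l (inv (\<alpha> l) x)))
      < (weight_inf \<eta> K)\<^sup>2 * ennreal (\<epsilon>\<^sup>2 / (1 - \<epsilon>)\<^sup>2)" .
  next
    fix s l assume s: "s \<in> {1..N}" and l: "l \<in> {1..N}" and ne: "s \<noteq> l"
    have "(SUP x\<in>E. ennreal (\<eta> (inv (\<alpha> l) (\<alpha> s x)) *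
       (w l (inv (\<alpha> l) (\<alpha> s x)) / w s x))) \<le> ennreal ?c"
      by (intro SUP_least ennreal_leI) (use R s l ne in blast)
    also have "\<dots> < ennreal (m * (\<epsilon> / (1 - \<epsilon>)))"
      using c1 by (intro ennreal_lessI) auto
    also have "\<dots> = weight_inf \<eta> K * ennreal (\<epsilon> / (1 - \<epsilon>))"
      using m by (simp flip: ennreal_mult')
    finally show "(SUP x\<in>E. ennreal (\<eta> (inv (\<alpha> l) (\<alpha> s x)) *
       (w l (inv (\<alpha> l) (\<alpha> s x)) / w s x))) < weight_inf \<eta> K * ennreal (\<epsilon> / (1 - \<epsilon>))" .
  qed (use E in auto)
qed

text \<open>
  The set \<open>E\<close> consists of the points of \<open>K\<close> where all functions in a finite family \<open>\<Phi>\<close> are small. The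
  family is made of the differences \<open>p\<close> of \<open>f\<close> and \<open>q\<^sub>l\<close> of \<open>\<rho>\<^sup>-\<^sup>1 T\<^sub>l f\<close> from the indicator of \<open>K\<close>, and of
  their translates; all of them have the same small norm.
\<close>

lemma admissible_if_near_indicator:
  assumes K: "indicator K \<in> Y" and N: "1 \<le> N"
    and K_disj: "\<And>l. l \<in> {1..N} \<Longrightarrow> K \<inter> \<alpha> l ` K = {}"
    and K_disj2: "\<And>s l. s \<in> {1..N} \<Longrightarrow> l \<in> {1..N} \<Longrightarrow> s \<noteq> l \<Longrightarrow> inv (\<alpha> l) ` (\<alpha> s ` K) \<inter> K = {}"
    and \<epsilon>: "0 < \<epsilon>" "\<epsilon> < 1" and m: "0 < m" "\<And>x. x \<in> K \<Longrightarrow> m \<le> \<eta> x"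
    and m_inf: "weight_inf \<eta> K = ennreal m" and rho_pos: "0 < \<rho>"
    and \<delta>: "\<delta> = m * \<epsilon> / 2 * \<epsilon> / 2"
    and f: "(\<lambda>x. f x - indicator K x) \<in> weighted_space Y \<eta>"
      "weighted_norm n \<eta> (\<lambda>x. f x - indicator K x) < \<delta>"
    and Tf: "\<And>l. l \<in> {1..N} \<Longrightarrow>
        (\<lambda>x. weighted_comp (w l) (\<alpha> l) (\<lambda>x. f x / of_real \<rho>) x - indicator K x) \<in> weighted_space Y \<eta>"
      "\<And>l. l \<in> {1..N} \<Longrightarrow>
        weighted_norm n \<eta> (\<lambda>x. weighted_comp (w l) (\<alpha> l) (\<lambda>x. f x / of_real \<rho>) x - indicator K x) < \<delta>"
  obtains E where "admissible \<epsilon> K E"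
proof -
  \<comment> \<open>Halving makes the bounds strict: a supremum of values below \<open>c\<close> may equal \<open>c\<close>.\<close>
  define c where c: "c = m * \<epsilon> / 2"
  define p where "p = (\<lambda>x. (f x - indicator K x) * of_real (\<eta> x))"
  define q where "q l = (\<lambda>x. (weighted_comp (w l) (\<alpha> l) (\<lambda>x. f x / of_real \<rho>) x - indicator K x) * of_real (\<eta> x))" for l
  have p: "p \<in> Y" "n p < \<delta>"
    using f by (simp_all add: weighted_space_def weighted_norm_def p_def)
  have q: "q l \<in> Y" "n (q l) < \<delta>" if "l \<in> {1..N}" for l
    using Tf[OF that] by (simp_all add: weighted_space_def weighted_norm_def q_def)
  \<comment> \<open>The last part contains the \<open>q l\<close> themselves, as the case \<open>s = l\<close>.\<close>
  define \<Phi> where "\<Phi> = {p} \<union> (\<lambda>s. p \<circ> \<alpha> s) ` {1..N} \<union> (\<lambda>l. q l \<circ> inv (\<alpha> l)) ` {1..N}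
      \<union> (\<lambda>(s, l). q l \<circ> inv (\<alpha> l) \<circ> \<alpha> s) ` ({1..N} \<times> {1..N})"
  have fin: "finite \<Phi>" unfolding \<Phi>_def by simp
  have \<Phi>: "\<phi> \<in> Y \<and> n \<phi> \<le> \<delta>" if "\<phi> \<in> \<Phi>" for \<phi>
    using that unfolding \<Phi>_def using p q by (auto simp: translate intro: less_imp_le)
  have card: "card \<Phi> \<le> 1 + N + N + N * N"
  proof -
    have "card ((\<lambda>s. p \<circ> \<alpha> s) ` {1..N}) \<le> N" "card ((\<lambda>l. q l \<circ> inv (\<alpha> l)) ` {1..N}) \<le> N"
      "card ((\<lambda>(s, l). q l \<circ> inv (\<alpha> l) \<circ> \<alpha> s) ` ({1..N} \<times> {1..N})) \<le> N * N"
      by (rule order_trans[OF card_image_le]; simp)+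
    then show ?thesis
      unfolding \<Phi>_def by (intro order_trans[OF card_Un_le] add_mono) auto
  qed
  have c0: "0 < c" using mult_pos_pos[OF m(1) \<epsilon>(1)] c by simp
  define E where "E = {x\<in>K. \<forall>\<phi>\<in>\<Phi>. cmod (\<phi> x) < c}"
  have "{x. \<forall>\<phi>\<in>\<Phi>. cmod (\<phi> x) < c} \<in> sets borel"
  proof -
    have "{x. cmod (\<phi> x) < c} \<in> sets borel" if "\<phi> \<in> \<Phi>" for \<phi>
    proof -
      have [measurable]: "\<phi> \<in> borel_measurable borel" using \<Phi>[OF that] measurable by blast
      show ?thesis by measurable
    qed
    moreover have "{x. \<forall>\<phi>\<in>\<Phi>. cmod (\<phi> x) < c} = (\<Inter>\<phi>\<in>\<Phi>. {x. cmod (\<phi> x) < c})" by auto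
    moreover have "\<Phi> \<noteq> {}" by (auto simp: \<Phi>_def)
    ultimately show ?thesis using fin by (auto intro!: sets.finite_INT)
  qed
  moreover have "E = K \<inter> {x. \<forall>\<phi>\<in>\<Phi>. cmod (\<phi> x) < c}" by (auto simp: E_def)
  ultimately have E: "E \<in> sets borel" using borel_set[OF K] by auto
  \<comment> \<open>Each of the at most \<open>(1 + N)\<^sup>2\<close> members of \<open>\<Phi>\<close> has modulus at least \<open>c\<close> only on a set of norm at
    most \<open>\<delta> / c = \<epsilon> / 2\<close>.\<close>
  have "n (indicator (K - E)) \<le> real (card \<Phi>) * (\<delta> / c)"
    by (rule chebyshev[OF K fin c0]) (use \<Phi> E borel_set[OF K] in \<open>auto simp: E_def not_less\<close>)
  also have "\<dots> \<le> real (1 + N + N + N * N) * (\<epsilon> / 2)"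
    using card c0 \<epsilon> unfolding \<delta> c[symmetric] by (intro mult_mono) (simp_all flip: of_nat_add of_nat_mult)
  also have "\<dots> = (1 + 2 * real N + real N * real N) * (\<epsilon> / 2)"
    by simp
  also have "\<dots> < (2 * ((4 + 2 * real N) * real N)) * (\<epsilon> / 2)"
  proof (rule mult_strict_right_mono)
    have "1 \<le> real N" "0 \<le> real N * real N" using N by simp_all
    moreover have "2 * ((4 + 2 * real N) * real N) = 8 * real N + 4 * (real N * real N)"
      by (simp add: algebra_simps)
    ultimately show "1 + 2 * real N + real N * real N < 2 * ((4 + 2 * real N) * real N)"
      by linarith
  qed (use \<epsilon>(1) in simp)
  also have "\<dots> = (4 + 2 * real N) * real N * \<epsilon>"
    by simp
  finally have nE: "n (indicator (K - E)) < (4 + 2 * real N) * real N * \<epsilon>" .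
  have off: "\<alpha> l x \<notin> K" "inv (\<alpha> l) x \<notin> K" if "l \<in> {1..N}" "x \<in> K" for l x
  proof -
    show "\<alpha> l x \<notin> K" using K_disj[OF that(1)] that(2) by auto
    show "inv (\<alpha> l) x \<notin> K"
      using K_disj[OF that(1)] that by (metis disjoint_iff image_eqI translation_inverse(1))
  qed
  have off2: "inv (\<alpha> l) (\<alpha> s x) \<notin> K" if "s \<in> {1..N}" "l \<in> {1..N}" "s \<noteq> l" "x \<in> K" for s l x
    using K_disj2[OF that(1-3)] that(4) by auto
  have near1: "1 - \<epsilon> < cmod z" if "cmod ((z - 1) * of_real (\<eta> x)) < c" "x \<in> K" for z x
  proof -
    have "cmod (z - 1) * m \<le> cmod (z - 1) * \<eta> x"
      using m(2)[OF that(2)] by (intro mult_left_mono) auto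
    also have "\<dots> < c" using that(1) weight_pos[of x] by (simp add: norm_mult)
    also have "\<dots> \<le> \<epsilon> * m" using c0 unfolding c by (simp add: mult.commute)
    finally have "cmod (z - 1) < \<epsilon>" using m(1) by simp
    then show ?thesis using norm_triangle_ineq[of z "1 - z"] by (simp add: norm_minus_commute)
  qed
  have large_f: "1 - \<epsilon> < cmod (f x)" if "x \<in> E" for x
  proof -
    have "cmod (p x) < c" using that by (auto simp: E_def \<Phi>_def)
    then show ?thesis using near1[of "f x" x] that by (auto simp: p_def E_def)
  qed
  have large_Tf: "1 - \<epsilon> < w l x * cmod (f (\<alpha> l x)) / \<rho>" if "l \<in> {1..N}" "x \<in> E" for l x
  proof -
    have "(q l \<circ> inv (\<alpha> l) \<circ> \<alpha> l) \<in> \<Phi>" using that(1) by (auto simp: \<Phi>_def)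
    then have "cmod ((q l \<circ> inv (\<alpha> l) \<circ> \<alpha> l) x) < c" using that(2) by (simp only: E_def) blast
    then have "cmod (q l x) < c" using that(1) by simp
    then have "1 - \<epsilon> < cmod (weighted_comp (w l) (\<alpha> l) (\<lambda>x. f x / of_real \<rho>) x)"
      using that by (intro near1[of _ x]) (auto simp: q_def E_def)
    then show ?thesis
      using w_pos[OF that(1), of x] rho_pos by (simp add: weighted_comp_def norm_mult norm_divide)
  qed
  have small_f: "\<eta> (\<alpha> s x) * cmod (f (\<alpha> s x)) < c" if "s \<in> {1..N}" "x \<in> E" for s x
  proof -
    have "(p \<circ> \<alpha> s) \<in> \<Phi>" using that(1) by (auto simp: \<Phi>_def)
    then have "cmod ((p \<circ> \<alpha> s) x) < c" using that(2) by (simp only: E_def) blast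
    then show ?thesis using off[OF that(1), of x] that(2) weight_pos[of "\<alpha> s x"]
      by (simp add: p_def E_def norm_mult mult.commute)
  qed
  have q_off: "cmod (q l y) = \<eta> y * (w l y * cmod (f (\<alpha> l y)) / \<rho>)" if "l \<in> {1..N}" "y \<notin> K" for l y
    using that w_pos[of l y] weight_pos[of y] rho_pos
    by (simp add: q_def weighted_comp_def norm_mult norm_divide)
  have small_Tf: "\<eta> (inv (\<alpha> l) x) * (w l (inv (\<alpha> l) x) * cmod (f x) / \<rho>) < c"
    if "l \<in> {1..N}" "x \<in> E" for l x
  proof -
    have "(q l \<circ> inv (\<alpha> l)) \<in> \<Phi>" using that(1) by (auto simp: \<Phi>_def)
    then have "cmod ((q l \<circ> inv (\<alpha> l)) x) < c" using that(2) by (simp only: E_def) blast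
    then show ?thesis using q_off[OF that(1), of "inv (\<alpha> l) x"] off(2)[OF that(1), of x] that
      by (simp add: E_def)
  qed
  have small_Tf2: "\<eta> (inv (\<alpha> l) (\<alpha> s x)) * (w l (inv (\<alpha> l) (\<alpha> s x)) * cmod (f (\<alpha> s x)) / \<rho>) < c"
    if "s \<in> {1..N}" "l \<in> {1..N}" "s \<noteq> l" "x \<in> E" for s l x
  proof -
    have "(q l \<circ> inv (\<alpha> l) \<circ> \<alpha> s) \<in> \<Phi>" using that(1,2) by (auto simp: \<Phi>_def)
    then have "cmod ((q l \<circ> inv (\<alpha> l) \<circ> \<alpha> s) x) < c" using that(4) by (simp only: E_def) blast
    then show ?thesis using q_off[OF that(2), of "inv (\<alpha> l) (\<alpha> s x)"] off2[OF that(1-3), of x] that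
      by (simp add: E_def)
  qed
  \<comment> \<open>All three weight bounds divide a product below \<open>c\<close> by one of the two values above \<open>1 - \<epsilon>\<close>.\<close>
  have quot: "a \<le> c / (1 - \<epsilon>)" if "a * b \<le> c" "1 - \<epsilon> < b" "0 \<le> a" for a b :: real
  proof -
    have "a * (1 - \<epsilon>) \<le> a * b" using that by (intro mult_left_mono) auto
    then show ?thesis using that \<epsilon> by (simp add: pos_le_divide_eq)
  qed
  have c_less: "c < m * \<epsilon>" unfolding c using mult_pos_pos[OF m(1) \<epsilon>(1)] by linarith
  show thesis
  proof (rule that, rule admissibleI[OF E _ nE m_inf m(1) \<epsilon> c0 c_less rho_pos])
    show "E \<subseteq> K" by (auto simp: E_def)
    show "\<eta> (\<alpha> s x) * (1 / w s x) \<le> c / (1 - \<epsilon>) / \<rho>" if "s \<in> {1..N}" "x \<in> E" for s x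
    proof -
      have "\<eta> (\<alpha> s x) * (1 / w s x) * \<rho> \<le> c / (1 - \<epsilon>)"
      proof (rule quot[OF _ large_Tf[OF that]])
        show "\<eta> (\<alpha> s x) * (1 / w s x) * \<rho> * (w s x * cmod (f (\<alpha> s x)) / \<rho>) \<le> c"
          using small_f[OF that] rho_pos w_pos[OF that(1), of x] by simp
        show "0 \<le> \<eta> (\<alpha> s x) * (1 / w s x) * \<rho>"
          using weight_pos[of "\<alpha> s x"] rho_pos w_pos[OF that(1), of x] by simp
      qed
      then show ?thesis using rho_pos by (simp only: pos_le_divide_eq)
    qed
    show "\<eta> (inv (\<alpha> l) x) * w l (inv (\<alpha> l) x) \<le> c / (1 - \<epsilon>) * \<rho>" if "l \<in> {1..N}" "x \<in> E" for l x
    proof -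
      have "\<eta> (inv (\<alpha> l) x) * w l (inv (\<alpha> l) x) / \<rho> \<le> c / (1 - \<epsilon>)"
      proof (rule quot[OF _ large_f[OF that(2)]])
        show "0 \<le> \<eta> (inv (\<alpha> l) x) * w l (inv (\<alpha> l) x) / \<rho>"
          using weight_pos[of "inv (\<alpha> l) x"] rho_pos w_pos[OF that(1), of "inv (\<alpha> l) x"] by simp
      qed (use small_Tf[OF that] in simp)
      then show ?thesis using rho_pos by (simp only: pos_divide_le_eq)
    qed
    show "\<eta> (inv (\<alpha> l) (\<alpha> s x)) * (w l (inv (\<alpha> l) (\<alpha> s x)) / w s x) \<le> c / (1 - \<epsilon>)"
      if "s \<in> {1..N}" "l \<in> {1..N}" "s \<noteq> l" "x \<in> E" for s l x
    proof (rule quot[OF _ large_Tf[OF that(1,4)]])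
      show "\<eta> (inv (\<alpha> l) (\<alpha> s x)) * (w l (inv (\<alpha> l) (\<alpha> s x)) / w s x) * (w s x * cmod (f (\<alpha> s x)) / \<rho>) \<le> c"
        using small_Tf2[OF that] w_pos[OF that(1), of x] by (simp add: less_imp_le)
      show "0 \<le> \<eta> (inv (\<alpha> l) (\<alpha> s x)) * (w l (inv (\<alpha> l) (\<alpha> s x)) / w s x)"
        using weight_pos[of "inv (\<alpha> l) (\<alpha> s x)"] w_pos[OF that(1), of x]
          w_pos[OF that(2), of "inv (\<alpha> l) (\<alpha> s x)"] by simp
    qed
  qed
qed

text \<open>
  Strict bounds on suprema become bounds at every point, and the bounds on products are balanced
  between the two factors.
\<close>

lemma admissibleE:
  assumes adm: "admissible \<epsilon> K E" and N: "1 \<le> N"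
    and m: "weight_inf \<eta> K = ennreal m" "0 < m" and \<epsilon>: "0 < \<epsilon>" "\<epsilon> < 1" and \<tau>: "\<tau> = m * (\<epsilon> / (1 - \<epsilon>))"
  obtains \<rho> where "0 < \<rho>" "\<forall>s\<in>{1..N}. \<forall>x\<in>E. \<rho> * (\<eta> (\<alpha> s x) * (1 / w s x)) \<le> \<tau>"
    "\<forall>l\<in>{1..N}. \<forall>x\<in>E. \<eta> (inv (\<alpha> l) x) * w l (inv (\<alpha> l) x) \<le> \<tau> * \<rho>"
    "\<forall>s\<in>{1..N}. \<forall>l\<in>{1..N}. s \<noteq> l \<longrightarrow> (\<forall>x\<in>E.
       \<eta> (inv (\<alpha> l) (\<alpha> s x)) * (w l (inv (\<alpha> l) (\<alpha> s x)) / w s x) \<le> \<tau>)"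
proof -
  have real_le: "u \<le> v" if "ennreal u < ennreal v" for u v
    using that by (meson ennreal_leI linorder_linear not_le)
  let ?a = "\<lambda>s x. \<eta> (\<alpha> s x) * (1 / w s x)" and ?b = "\<lambda>l x. \<eta> (inv (\<alpha> l) x) * w l (inv (\<alpha> l) x)"
    and ?d = "\<lambda>s l x. \<eta> (inv (\<alpha> l) (\<alpha> s x)) * (w l (inv (\<alpha> l) (\<alpha> s x)) / w s x)"
  have a_pos: "0 < ?a s x" if "s \<in> {1..N}" for s x
    using w_pos[OF that] weight_pos by simp
  have b_pos: "0 < ?b l x" if "l \<in> {1..N}" for l x
    using w_pos[OF that] weight_pos by simp
  have ab: "?a s x * ?b l y \<le> \<tau>\<^sup>2" if l: "l \<in> {1..N}" and s: "s \<in> {1..N}" and xy: "x \<in> E" "y \<in> E" for l s x y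
  proof -
    have "ennreal (?a s x * ?b l y) = ennreal (?a s x) * ennreal (?b l y)"
      using a_pos[OF s, of x] by (intro ennreal_mult') simp
    also have "\<dots> \<le> (SUP x\<in>E. ennreal (?a s x)) * (SUP x\<in>E. ennreal (?b l x))"
      by (intro mult_mono SUP_upper xy) auto
    also have "\<dots> < (weight_inf \<eta> K)\<^sup>2 * ennreal (\<epsilon>\<^sup>2 / (1 - \<epsilon>)\<^sup>2)"
      using adm l s unfolding admissible_def by blast
    also have "\<dots> = ennreal (\<tau>\<^sup>2)"
      using weight_bound_squared[OF m] by (simp add: \<tau>)
    finally show ?thesis by (rule real_le)
  qed
  have d: "?d s l x \<le> \<tau>" if s: "s \<in> {1..N}" and l: "l \<in> {1..N}" and ne: "s \<noteq> l" and x: "x \<in> E" for s l x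
  proof -
    have "ennreal (?d s l x) \<le> (SUP x\<in>E. ennreal (?d s l x))"
      by (rule SUP_upper[OF x])
    also have "\<dots> < weight_inf \<eta> K * ennreal (\<epsilon> / (1 - \<epsilon>))"
      using adm l s ne unfolding admissible_def by blast
    also have "\<dots> = ennreal \<tau>"
      using m by (simp add: \<tau> flip: ennreal_mult')
    finally show ?thesis by (rule real_le)
  qed
  have \<tau>0: "0 < \<tau>" using m \<epsilon> by (simp add: \<tau>)
  have "1 \<in> {1..N}" using N by simp
  then obtain \<rho> where \<rho>: "0 < \<rho>" "\<forall>s\<in>{1..N}. \<forall>x\<in>E. \<rho> * ?a s x \<le> \<tau>"
      "\<forall>l\<in>{1..N}. \<forall>x\<in>E. ?b l x \<le> \<tau> * \<rho>"
    by (rule balancing_factor[where a = ?a and b = ?b, OF _ \<tau>0 a_pos b_pos ab])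
  show thesis
    by (rule that[OF \<rho>]) (use d in blast)
qed

text \<open>
  The function \<open>h = f \<chi>\<^sub>E + \<Sum>\<^sub>s \<rho> S\<^sub>s (g\<^sub>s \<chi>\<^sub>E)\<close>, whose summands are called \<open>piece s\<close>. In \<open>h - f\<close> there
  remain \<open>f\<close> on \<open>K - E\<close> and the \<open>N\<close> pieces; in \<open>\<rho>\<^sup>-\<^sup>1 T\<^sub>l h - g\<^sub>l\<close> there remain \<open>g\<^sub>l\<close> on \<open>K - E\<close>, the
  image of \<open>f \<chi>\<^sub>E\<close> and the images of the \<open>N - 1\<close> pieces with \<open>s \<noteq> l\<close>. So \<open>N\<close> terms transported from
  \<open>E\<close> have to be estimated in both cases.
\<close>

lemma common_preimage:
  fixes f :: "'x \<Rightarrow> complex" and g :: "nat \<Rightarrow> 'x \<Rightarrow> complex"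
  assumes K: "indicator K \<in> Y" and E: "E \<in> sets borel" "E \<subseteq> K"
    and rho_pos: "0 < \<rho>" and B: "0 \<le> B" and \<tau>: "0 \<le> \<tau>" and M: "0 \<le> M" "\<And>x. x \<in> K \<Longrightarrow> \<eta> x \<le> M"
    and f: "f \<in> borel_measurable borel" "\<And>x. cmod (f x) \<le> B" "\<And>x. x \<notin> K \<Longrightarrow> f x = 0"
    and g: "\<And>l. l \<in> {1..N} \<Longrightarrow> g l \<in> borel_measurable borel"
      "\<And>l x. l \<in> {1..N} \<Longrightarrow> cmod (g l x) \<le> B" "\<And>l x. l \<in> {1..N} \<Longrightarrow> x \<notin> K \<Longrightarrow> g l x = 0"
    and P: "\<And>s x. s \<in> {1..N} \<Longrightarrow> x \<in> E \<Longrightarrow> \<rho> * (\<eta> (\<alpha> s x) * (1 / w s x)) \<le> \<tau>"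
    and Q: "\<And>l x. l \<in> {1..N} \<Longrightarrow> x \<in> E \<Longrightarrow> \<eta> (inv (\<alpha> l) x) * w l (inv (\<alpha> l) x) \<le> \<tau> * \<rho>"
    and R: "\<And>s l x. s \<in> {1..N} \<Longrightarrow> l \<in> {1..N} \<Longrightarrow> s \<noteq> l \<Longrightarrow> x \<in> E \<Longrightarrow>
       \<eta> (inv (\<alpha> l) (\<alpha> s x)) * (w l (inv (\<alpha> l) (\<alpha> s x)) / w s x) \<le> \<tau>"
    and D: "D = B * (M * n (indicator (K - E)) + real N * \<tau> * n (indicator K))"
  obtains h where "h \<in> weighted_space Y \<eta>" "weighted_norm n \<eta> (\<lambda>x. h x - f x) \<le> D"
    "\<forall>l\<in>{1..N}. weighted_comp (w l) (\<alpha> l) (\<lambda>x. h x / of_real \<rho>) \<in> weighted_space Y \<eta>"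
    "\<forall>l\<in>{1..N}.
       weighted_norm n \<eta> (\<lambda>x. weighted_comp (w l) (\<alpha> l) (\<lambda>x. h x / of_real \<rho>) x - g l x) \<le> D"
proof -
  let ?Z = "weighted_space Y \<eta>" and ?n = "weighted_norm n \<eta>" and ?\<kappa> = "n (indicator K)"
  have eta: "\<And>x. 0 \<le> \<eta> x" using weight_pos less_imp_le by blast
  note [measurable] = E(1) borel_set[OF K] f(1)
  have KE: "indicator (K - E) \<in> Y"
    by (rule indicator_subset[OF K]) auto
  have rest: "(\<lambda>x. u x * indicator (K - E) x) \<in> ?Z \<and> ?n (\<lambda>x. u x * indicator (K - E) x) \<le> B * M * n (indicator (K - E))"
    if u: "u \<in> borel_measurable borel" "\<And>x. cmod (u x) \<le> B" for u
  proof -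
    have m: "(\<lambda>x. u x * indicator (K - E) x) \<in> borel_measurable borel"
      using u(1) by measurable
    have "cmod (u x * indicator (K - E) x) * \<eta> x \<le> B * M * cmod (indicator (K - E) x)" for x
      using u(2)[of x] M(2)[of x] eta[of x] B by (auto simp: indicator_def intro!: mult_mono)
    from weighted_dominated[OF KE m _ this] B M(1) show ?thesis by simp
  qed
  have in_Z: "u \<in> ?Z" if u: "u \<in> borel_measurable borel" "\<And>x. cmod (u x) \<le> B" "\<And>x. x \<notin> K \<Longrightarrow> u x = 0" for u
  proof (rule weighted_dominated(1)[OF K u(1)])
    show "cmod (u x) * \<eta> x \<le> B * M * cmod (indicator K x)" for x
      using u(2)[of x] u(3)[of x] M(2)[of x] eta[of x] B by (auto simp: indicator_def intro!: mult_mono)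
  qed (use B M in simp)
  define piece where "piece s = (\<lambda>y. of_real \<rho> * (g s (inv (\<alpha> s) y) * indicator E (inv (\<alpha> s) y) / of_real (w s (inv (\<alpha> s) y))))" for s
  let ?T = "\<lambda>l u. weighted_comp (w l) (\<alpha> l) (\<lambda>x. u x / of_real \<rho>)"
  \<comment> \<open>Each transported term is controlled by the indicator of \<open>K\<close> composed with the map \<open>\<beta>\<close> that
    brings its support back into \<open>E\<close>, and that composition has the norm of the indicator.\<close>
  have transported: "v \<in> ?Z \<and> ?n v \<le> \<tau> * B * ?\<kappa>"
    if v: "v \<in> borel_measurable borel" and \<beta>: "indicator K \<circ> \<beta> \<in> Y" "n (indicator K \<circ> \<beta>) = ?\<kappa>"
      and bound: "\<And>y. cmod (v y) * \<eta> y \<le> \<tau> * B * indicator E (\<beta> y)" for v \<beta>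
  proof -
    have "cmod (v y) * \<eta> y \<le> \<tau> * B * cmod ((indicator K \<circ> \<beta>) y)" for y
      using bound[of y] E(2) \<tau> B by (cases "\<beta> y \<in> E") (auto simp: subset_eq indicator_def intro: order_trans)
    from weighted_dominated[OF \<beta>(1) v _ this] \<tau> B show ?thesis by (simp only: \<beta>(2) mult_nonneg_nonneg)
  qed
  have piece: "piece s \<in> ?Z \<and> ?n (piece s) \<le> \<tau> * B * ?\<kappa>" if s: "s \<in> {1..N}" for s
  proof (rule transported[of _ "inv (\<alpha> s)"])
    note [measurable] = translation_measurable[OF s] w_measurable[OF s] g(1)[OF s]
    show "piece s \<in> borel_measurable borel" unfolding piece_def by measurable
    fix y
    show "cmod (piece s y) * \<eta> y \<le> \<tau> * B * indicator E (inv (\<alpha> s) y)"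
    proof (cases "inv (\<alpha> s) y \<in> E")
      case True
      then have "\<rho> * (\<eta> y * (1 / w s (inv (\<alpha> s) y))) * cmod (g s (inv (\<alpha> s) y)) \<le> \<tau> * B"
        using P[OF s True] g(2)[OF s, of "inv (\<alpha> s) y"] s \<tau> by (intro mult_mono) auto
      then show ?thesis using True rho_pos w_pos[OF s, of "inv (\<alpha> s) y"]
        by (simp add: piece_def norm_mult norm_divide mult_ac)
    qed (simp add: piece_def)
  qed (use translate[OF K s] in auto)
  have T_f: "?T l (\<lambda>x. f x * indicator E x) \<in> ?Z \<and> ?n (?T l (\<lambda>x. f x * indicator E x)) \<le> \<tau> * B * ?\<kappa>"
    if l: "l \<in> {1..N}" for l
  proof (rule transported[of _ "\<alpha> l"])
    note [measurable] = translation_measurable[OF l] w_measurable[OF l]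
    show "?T l (\<lambda>x. f x * indicator E x) \<in> borel_measurable borel"
      unfolding weighted_comp_def by measurable
    fix y
    show "cmod (?T l (\<lambda>x. f x * indicator E x) y) * \<eta> y \<le> \<tau> * B * indicator E (\<alpha> l y)"
    proof (cases "\<alpha> l y \<in> E")
      case True
      have "\<eta> y * w l y / \<rho> \<le> \<tau>" using Q[OF l True] l rho_pos by (simp add: pos_divide_le_eq)
      then have "(\<eta> y * w l y / \<rho>) * cmod (f (\<alpha> l y)) \<le> \<tau> * B"
        using f(2)[of "\<alpha> l y"] \<tau> by (intro mult_mono) auto
      then show ?thesis using True rho_pos w_pos[OF l, of y]
        by (simp add: weighted_comp_def norm_mult norm_divide mult_ac)
    qed (simp add: weighted_comp_def)
  qed (use translate[OF K l] in auto)
  have T_piece: "?T l (piece s) \<in> ?Z \<and> ?n (?T l (piece s)) \<le> \<tau> * B * ?\<kappa>"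
    if l: "l \<in> {1..N}" and s: "s \<in> {1..N}" and ne: "s \<noteq> l" for l s
  proof (rule transported[of _ "inv (\<alpha> s) \<circ> \<alpha> l"])
    note [measurable] = translation_measurable[OF l] w_measurable[OF l]
      translation_measurable[OF s] w_measurable[OF s] g(1)[OF s]
    show "?T l (piece s) \<in> borel_measurable borel"
      unfolding weighted_comp_def piece_def by measurable
    fix y
    let ?x = "inv (\<alpha> s) (\<alpha> l y)"
    show "cmod (?T l (piece s) y) * \<eta> y \<le> \<tau> * B * indicator E ((inv (\<alpha> s) \<circ> \<alpha> l) y)"
    proof (cases "?x \<in> E")
      case True
      have "\<eta> y * (w l y / w s ?x) \<le> \<tau>" using R[OF s l ne True] l s by simp
      then have "(\<eta> y * (w l y / w s ?x)) * cmod (g s ?x) \<le> \<tau> * B"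
        using g(2)[OF s, of ?x] \<tau> by (intro mult_mono) auto
      then show ?thesis using True rho_pos w_pos[OF l, of y] w_pos[OF s, of ?x]
        by (simp add: weighted_comp_def piece_def norm_mult norm_divide mult_ac)
    qed (simp add: weighted_comp_def piece_def)
  qed (use translate[OF K s] translate[OF translate(3)[OF K s] l] in \<open>auto simp: comp_assoc\<close>)
  have T_piece_same: "?T s (piece s) y = g s y * indicator E y" if s: "s \<in> {1..N}" for s y
    using s rho_pos w_pos[OF s, of y] by (simp add: weighted_comp_def piece_def)
  have split: "u x * indicator E x = u x - u x * indicator (K - E) x"
    if "\<And>x. x \<notin> K \<Longrightarrow> u x = 0" for u :: "'x \<Rightarrow> complex" and x
    using that[of x] E(2) by (auto simp: indicator_def)
  let ?h = "\<lambda>x. f x * indicator E x + (\<Sum>s\<in>{1..N}. piece s x)"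
  have sum_piece: "(\<lambda>x. \<Sum>s\<in>{1..N}. piece s x) \<in> ?Z" "?n (\<lambda>x. \<Sum>s\<in>{1..N}. piece s x) \<le> real N * (\<tau> * B * ?\<kappa>)"
    using weighted.sum[of "{1..N}" piece "\<tau> * B * ?\<kappa>"] piece by auto
  have h_eq: "(\<lambda>x. ?h x - f x) = (\<lambda>x. (\<Sum>s\<in>{1..N}. piece s x) - f x * indicator (K - E) x)"
    using split[of f, OF f(3)] by (simp add: fun_eq_iff)
  have hf: "(\<lambda>x. ?h x - f x) \<in> ?Z" "?n (\<lambda>x. ?h x - f x) \<le> D"
    unfolding h_eq using weighted.diff[OF sum_piece(1) conjunct1[OF rest[OF f(1,2)]]] sum_piece(2) rest[OF f(1,2)]
    by (auto simp: D algebra_simps)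
  have Th: "(\<lambda>x. ?T l ?h x - g l x) \<in> ?Z" "?n (\<lambda>x. ?T l ?h x - g l x) \<le> D" if l: "l \<in> {1..N}" for l
  proof -
    let ?v = "\<lambda>x. \<Sum>s\<in>{1..N} - {l}. ?T l (piece s) x"
    have v: "?v \<in> ?Z" "?n ?v \<le> (real N - 1) * (\<tau> * B * ?\<kappa>)"
      using weighted.sum[of "{1..N} - {l}" "\<lambda>s. ?T l (piece s)" "\<tau> * B * ?\<kappa>"] T_piece[OF l] l
      by (auto simp: of_nat_diff)
    have eq: "(\<lambda>x. ?T l ?h x - g l x) =
        (\<lambda>x. (?T l (\<lambda>x. f x * indicator E x) x + ?v x) - g l x * indicator (K - E) x)" (is "?lhs = ?rhs")
    proof
      fix x
      have "?T l ?h x = ?T l (\<lambda>x. f x * indicator E x) x + (\<Sum>s\<in>{1..N}. ?T l (piece s) x)"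
        by (simp add: weighted_comp_def add_divide_distrib distrib_left sum_divide_distrib sum_distrib_left)
      also have "(\<Sum>s\<in>{1..N}. ?T l (piece s) x) = ?T l (piece l) x + ?v x"
        by (rule sum.remove[OF _ l]) simp
      finally show "?lhs x = ?rhs x"
        using split[of "g l", OF g(3)[OF l], of x] by (simp add: T_piece_same[OF l])
    qed
    note fv = weighted.add[OF conjunct1[OF T_f[OF l]] v(1)]
    show "(\<lambda>x. ?T l ?h x - g l x) \<in> ?Z" "?n (\<lambda>x. ?T l ?h x - g l x) \<le> D"
      unfolding eq
      using weighted.diff[OF fv(1) conjunct1[OF rest[OF g(1,2)[OF l]]]] fv(2) v(2) T_f[OF l] rest[OF g(1,2)[OF l]]
      by (auto simp: D algebra_simps)
  qed
  show thesis
  proof (intro that[OF _ hf(2)] ballI)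
    show "?h \<in> ?Z" using weighted.add(1)[OF hf(1) in_Z[OF f]] by simp
    show "?n (\<lambda>x. ?T l ?h x - g l x) \<le> D" if "l \<in> {1..N}" for l
      by (rule Th(2)[OF that])
    show "?T l ?h \<in> ?Z" if l: "l \<in> {1..N}" for l
      using weighted.add(1)[OF Th(1)[OF l] in_Z[OF g[OF l]]] by simp
  qed
qed

end

section \<open>Characterisation of semi-transitivity\<close>

theorem theorem5p6:
  fixes Y :: "('x::topological_space \<Rightarrow> complex) set"
    and nY :: "('x \<Rightarrow> complex) \<Rightarrow> real"
    and S :: "'t set" and \<F> :: "'t set set" and N :: nat
    and \<alpha> :: "'t \<Rightarrow> nat \<Rightarrow> 'x \<Rightarrow> 'x"
    and w :: "'t \<Rightarrow> nat \<Rightarrow> 'x \<Rightarrow> real"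
    and \<eta> :: "'x \<Rightarrow> real"
  assumes "banach_function_space Y nY" and "solid_space Y nY"
    and "\<And>K. compact K \<Longrightarrow> indicator K \<in> Y"
    and "fun_topology Y nY closure_of bounded_compact_support Y = Y"
    and "\<F> \<subseteq> Pow S" and "1 \<le> N"
    and "\<And>t l. t \<in> S \<Longrightarrow> l \<in> {1..N} \<Longrightarrow> homeomorphism UNIV UNIV (\<alpha> t l) (inv (\<alpha> t l))"
    and "\<And>t l. t \<in> S \<Longrightarrow> l \<in> {1..N} \<Longrightarrow> invariant_under (\<alpha> t l) Y nY"
    and "disjoint_aperiodic \<F> N \<alpha>"
    and "\<And>t l. t \<in> S \<Longrightarrow> l \<in> {1..N} \<Longrightarrow> w t l \<in> borel_measurable borel"
    and "\<And>t l x. t \<in> S \<Longrightarrow> l \<in> {1..N} \<Longrightarrow> 0 < w t l x"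
    and "\<And>t l. t \<in> S \<Longrightarrow> l \<in> {1..N} \<Longrightarrow> bounded (range (w t l))"
    and "\<And>t l K. t \<in> S \<Longrightarrow> l \<in> {1..N} \<Longrightarrow> compact K \<Longrightarrow> bounded ((\<lambda>x. 1 / w t l x) ` K)"
    and "continuous_on UNIV \<eta>" and "\<And>x. 0 < \<eta> x"
    and "\<And>t l. t \<in> S \<Longrightarrow> l \<in> {1..N} \<Longrightarrow> weight_wrt (\<alpha> t l) \<eta>"
  shows "dF_semi_transitive \<F> N (weighted_space Y \<eta>) (weighted_norm nY \<eta>)
           (\<lambda>t l. weighted_comp (w t l) (\<alpha> t l))
    \<longleftrightarrow>
    (\<forall>\<epsilon>::real. \<forall>K. 0 < \<epsilon> \<and> \<epsilon> < 1 \<and> compact K \<longrightarrow>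
      (\<exists>F\<in>\<F>. \<exists>E :: 't \<Rightarrow> 'x set. \<forall>t\<in>F.
         E t \<in> sets borel \<and> E t \<subseteq> K \<and>
         nY (indicator (K - E t)) < (4 + 2 * real N) * real N * \<epsilon> \<and>
         (\<forall>l\<in>{1..N}. \<forall>s\<in>{1..N}.
            (SUP x\<in>E t. ennreal (\<eta> (\<alpha> t s x) * (1 / w t s x))) *
            (SUP x\<in>E t. ennreal (\<eta> (inv (\<alpha> t l) x) * w t l (inv (\<alpha> t l) x)))
            < (weight_inf \<eta> K)\<^sup>2 * ennreal (\<epsilon>\<^sup>2 / (1 - \<epsilon>)\<^sup>2)) \<and>
         (\<forall>s\<in>{1..N}. \<forall>l\<in>{1..N}. s \<noteq> l \<longrightarrow>
            (SUP x\<in>E t. ennreal (\<eta> (inv (\<alpha> t l) (\<alpha> t s x)) *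
               (w t l (inv (\<alpha> t l) (\<alpha> t s x)) / w t s x)))
            < weight_inf \<eta> K * ennreal (\<epsilon> / (1 - \<epsilon>)))))"
proof -
  note banach = assms(1) and solidY = assms(2) and compact_mem = assms(3) and dense = assms(4)
    and sub = assms(5) and N = assms(6) and hom = assms(7) and inva = assms(8) and aperiodic = assms(9)
    and w_meas = assms(10) and w_pos = assms(11) and eta_cont = assms(14) and eta_pos = assms(15)
  let ?Z = "weighted_space Y \<eta>" and ?n = "weighted_norm nY \<eta>"
    and ?T = "\<lambda>t l. weighted_comp (w t l) (\<alpha> t l)"
  interpret Y: weighted_function_space Y nY \<eta>
    using banach solidY eta_cont eta_pos by unfold_locales (auto simp: banach_function_space_def)
  have system: "weighted_translations Y nY \<eta> N (\<alpha> t) (w t)" if "t \<in> S" for t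
    using hom[OF that] inva[OF that] w_meas[OF that] w_pos[OF that] by unfold_locales auto
  let ?good = "\<lambda>\<epsilon> K t E. E \<in> sets borel \<and> E \<subseteq> K \<and>
         nY (indicator (K - E)) < (4 + 2 * real N) * real N * \<epsilon> \<and>
         (\<forall>l\<in>{1..N}. \<forall>s\<in>{1..N}.
            (SUP x\<in>E. ennreal (\<eta> (\<alpha> t s x) * (1 / w t s x))) *
            (SUP x\<in>E. ennreal (\<eta> (inv (\<alpha> t l) x) * w t l (inv (\<alpha> t l) x)))
            < (weight_inf \<eta> K)\<^sup>2 * ennreal (\<epsilon>\<^sup>2 / (1 - \<epsilon>)\<^sup>2)) \<and>
         (\<forall>s\<in>{1..N}. \<forall>l\<in>{1..N}. s \<noteq> l \<longrightarrow>
            (SUP x\<in>E. ennreal (\<eta> (inv (\<alpha> t l) (\<alpha> t s x)) *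
               (w t l (inv (\<alpha> t l) (\<alpha> t s x)) / w t s x)))
            < weight_inf \<eta> K * ennreal (\<epsilon> / (1 - \<epsilon>)))"
  show ?thesis (is "?lhs \<longleftrightarrow> ?rhs")
  proof
    assume L: ?lhs
    show ?rhs
    proof (intro allI impI, elim conjE)
      fix \<epsilon> :: real and K :: "'x set"
      assume \<epsilon>: "0 < \<epsilon>" "\<epsilon> < 1" and K: "compact K"
      show "\<exists>F\<in>\<F>. \<exists>E. \<forall>t\<in>F. ?good \<epsilon> K t (E t)"
      proof (cases "K = {}")
        case True
        \<comment> \<open>The infimum of \<open>\<eta>\<close> over the empty set is infinite, so \<open>E\<^sub>t = {}\<close> satisfies everything.\<close>
        have "openin (fun_topology ?Z ?n) ?Z"
          unfolding Y.weighted.openin_iff by (auto intro: exI[of _ 1])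
        then obtain F where F: "F \<in> \<F>"
          using L[unfolded dF_semi_transitive_def, rule_format, of ?Z "\<lambda>_. ?Z"] Y.weighted.zero by auto
        have "indicator {} = (\<lambda>x::'x. 0::complex)" by (simp add: fun_eq_iff)
        then have "nY (indicator {}) = 0" using Y.norm_zero by simp
        moreover have "0 < (4 + 2 * real N) * real N * \<epsilon>" using N \<epsilon> by simp
        moreover have "top * ennreal (\<epsilon> / (1 - \<epsilon>)) = top" "top * ennreal (\<epsilon>\<^sup>2 / (1 - \<epsilon>)\<^sup>2) = top"
          using \<epsilon> by (simp_all add: ennreal_top_mult)
        ultimately show ?thesis
          using F by (intro bexI[OF _ F] exI[of _ "\<lambda>_. {}"]) (simp add: True weight_inf_def bot_ennreal)
      next
        case False
        obtain x0 where x0: "x0 \<in> K" "\<And>x. x \<in> K \<Longrightarrow> \<eta> x0 \<le> \<eta> x" "weight_inf \<eta> K = ennreal (\<eta> x0)"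
          using weight_inf_attained[OF eta_cont K False] by blast
        define m where "m = \<eta> x0"
        define \<delta> where "\<delta> = m * \<epsilon> / 2 * \<epsilon> / 2"
        have m: "0 < m" using eta_pos by (simp add: m_def)
        have m_inf: "weight_inf \<eta> K = ennreal m" using x0(3) by (simp add: m_def)
        have \<delta>: "0 < \<delta>" using m \<epsilon> by (simp add: \<delta>_def)
        have \<chi>: "indicator K \<in> ?Z" by (rule Y.compact_indicator_weighted[OF K compact_mem[OF K]])
        let ?U = "{h\<in>?Z. ?n (\<lambda>x. h x - indicator K x) < \<delta>}"
        have "openin (fun_topology ?Z ?n) ?U" by (rule Y.weighted.openin_ball[OF \<chi>])
        moreover have "indicator K \<in> ?U" using \<chi> \<delta> Y.weighted.norm_zero by simp
        then have "?U \<noteq> {}" by blast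
        ultimately obtain H where H: "H \<in> \<F>"
          "\<And>t. t \<in> H \<Longrightarrow> \<exists>r::real. 0 < r \<and>
            ?U \<inter> (\<Inter>l\<in>{1..N}. {(\<lambda>x. of_real r * f x) | f. f \<in> ?Z \<and> ?T t l f \<in> ?U}) \<noteq> {}"
          using L[unfolded dF_semi_transitive_def, rule_format, of ?U "\<lambda>_. ?U"] by meson
        obtain F where F: "F \<in> \<F>" "F \<subseteq> H"
          and disj: "\<And>t l. t \<in> F \<Longrightarrow> l \<in> {1..N} \<Longrightarrow> K \<inter> \<alpha> t l ` K = {}"
            "\<And>t s l. t \<in> F \<Longrightarrow> s \<in> {1..N} \<Longrightarrow> l \<in> {1..N} \<Longrightarrow> s \<noteq> l \<Longrightarrow> inv (\<alpha> t l) ` (\<alpha> t s ` K) \<inter> K = {}"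
          using aperiodic[unfolded disjoint_aperiodic_def, rule_format, OF H(1) K] by meson
        have "\<exists>E. ?good \<epsilon> K t E" if t: "t \<in> F" for t
        proof -
          have "t \<in> S" using t F(1) sub by blast
          then interpret t: weighted_translations Y nY \<eta> N "\<alpha> t" "w t" by (rule system)
          have "t \<in> H" using t F(2) by blast
          from H(2)[OF this] obtain r where r: "0 < r" and
            "?U \<inter> (\<Inter>l\<in>{1..N}. {(\<lambda>x. of_real r * f x) | f. f \<in> ?Z \<and> ?T t l f \<in> ?U}) \<noteq> {}"
            by (elim exE conjE)
          then obtain h where h: "h \<in> ?U"
            "h \<in> (\<Inter>l\<in>{1..N}. {(\<lambda>x. of_real r * f x) | f. f \<in> ?Z \<and> ?T t l f \<in> ?U})"
            unfolding ex_in_conv[symmetric] by (elim exE IntE)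
          have Th: "?T t l (\<lambda>x. h x / of_real r) \<in> ?U" if l: "l \<in> {1..N}" for l
          proof -
            obtain f where f: "h = (\<lambda>x. of_real r * f x)" "?T t l f \<in> ?U"
              using h(2) l by blast
            then have "(\<lambda>x. h x / of_real r) = f" using r by simp
            then show ?thesis using f(2) by simp
          qed
          obtain E where "t.admissible \<epsilon> K E"
          proof (rule t.admissible_if_near_indicator[OF compact_mem[OF K] N disj(1)[OF t] disj(2)[OF t] \<epsilon> m _ m_inf r \<delta>_def])
            show "m \<le> \<eta> x" if "x \<in> K" for x using x0(2)[OF that] by (simp add: m_def)
            show "(\<lambda>x. h x - indicator K x) \<in> ?Z" "?n (\<lambda>x. h x - indicator K x) < \<delta>"
              using h(1) Y.weighted.diff(1)[OF _ \<chi>] by auto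
            show "(\<lambda>x. ?T t l (\<lambda>x. h x / of_real r) x - indicator K x) \<in> ?Z"
              "?n (\<lambda>x. ?T t l (\<lambda>x. h x / of_real r) x - indicator K x) < \<delta>" if "l \<in> {1..N}" for l
              using Th[OF that] Y.weighted.diff(1)[OF _ \<chi>] by auto
          qed
          then show ?thesis unfolding t.admissible_def by (rule exI[where x = E])
        qed
        then have "\<exists>E. \<forall>t\<in>F. ?good \<epsilon> K t (E t)" by (rule bchoice[OF ballI])
        then show ?thesis by (rule bexI[OF _ F(1)])
      qed
    qed
  next
    assume R: ?rhs
    show ?lhs
      unfolding dF_semi_transitive_def
    proof (intro allI impI, elim conjE)
      fix U :: "('x \<Rightarrow> complex) set" and V :: "nat \<Rightarrow> ('x \<Rightarrow> complex) set"
      assume U: "openin (fun_topology ?Z ?n) U" "U \<noteq> {}"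
        and V: "\<forall>l\<in>{1..N}. openin (fun_topology ?Z ?n) (V l) \<and> V l \<noteq> {}"
      \<comment> \<open>Treating \<open>U\<close> as number \<open>0\<close> of the open sets gives one common \<open>K\<close>, \<open>B\<close> and \<open>r\<close>.\<close>
      define W where "W l = (if l = 0 then U else V l)" for l
      obtain f K B r where f: "\<forall>l\<in>{0..N}. f l \<in> borel_measurable borel"
          "\<forall>l\<in>{0..N}. \<forall>x. cmod (f l x) \<le> B"
        and K: "compact K" "K \<noteq> {}" and f0: "\<forall>l\<in>{0..N}. \<forall>x. x \<notin> K \<longrightarrow> f l x = 0"
        and B: "0 \<le> B" and r: "0 < r"
        and near: "\<forall>l\<in>{0..N}. \<forall>h\<in>?Z. ?n (\<lambda>x. h x - f l x) < r \<longrightarrow> h \<in> W l"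
        by (rule Y.bounded_compact_in_opens[OF dense, of "{0..N}" W]) (use U V in \<open>auto simp: W_def\<close>)
      obtain x0 where x0: "weight_inf \<eta> K = ennreal (\<eta> x0)"
        by (rule weight_inf_attained[OF eta_cont K]) (rule that)
      define m where "m = \<eta> x0"
      have m: "0 < m" using eta_pos by (simp add: m_def)
      have m_inf: "weight_inf \<eta> K = ennreal m" using x0 by (simp add: m_def)
      obtain M where M: "0 \<le> M" "\<And>x. x \<in> K \<Longrightarrow> \<eta> x \<le> M"
        using Y.weight_bounded[OF K(1)] by blast
      let ?\<kappa> = "nY (indicator K)"
      have \<kappa>: "0 \<le> ?\<kappa>" by (rule Y.norm_nonneg[OF compact_mem[OF K(1)]])
      \<comment> \<open>For \<open>\<epsilon> \<le> 1/2\<close> the error in the approximation is at most \<open>C \<epsilon>\<close>, because then \<open>\<tau> \<le> 2 m \<epsilon>\<close>; the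
        summand \<open>1\<close> makes \<open>C\<close> positive.\<close>
      define C where "C = B * (M * ((4 + 2 * real N) * real N) + real N * (2 * m) * ?\<kappa>) + 1"
      have C: "0 < C" unfolding C_def using B M(1) m \<kappa> by (intro add_nonneg_pos) simp_all
      define \<epsilon> where "\<epsilon> = min (1 / 2) (r / C / 2)"
      have \<epsilon>: "0 < \<epsilon>" "\<epsilon> \<le> 1 / 2"
      proof -
        show "0 < \<epsilon>" using r C by (simp add: \<epsilon>_def)
        show "\<epsilon> \<le> 1 / 2" unfolding \<epsilon>_def by (rule min.cobounded1)
      qed
      have "C * \<epsilon> < r"
      proof -
        have "C * \<epsilon> \<le> C * (r / C / 2)"
          using C by (intro mult_left_mono) (simp_all add: \<epsilon>_def)
        also have "\<dots> = r / 2" using C by simp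
        finally show ?thesis using r by simp
      qed
      define \<tau> where "\<tau> = m * (\<epsilon> / (1 - \<epsilon>))"
      have \<tau>: "0 < \<tau>" "\<tau> \<le> 2 * m * \<epsilon>"
      proof -
        show "0 < \<tau>" using m \<epsilon> by (simp add: \<tau>_def)
        have "\<epsilon> / (1 - \<epsilon>) \<le> \<epsilon> / (1 / 2)" using \<epsilon> by (intro divide_left_mono) auto
        then have "\<tau> \<le> m * (\<epsilon> / (1 / 2))"
          unfolding \<tau>_def using m by (intro mult_left_mono) auto
        then show "\<tau> \<le> 2 * m * \<epsilon>" by simp
      qed
      have \<epsilon>_less: "\<epsilon> < 1" using \<epsilon> by simp
      have "0 < \<epsilon> \<and> \<epsilon> < 1 \<and> compact K" using \<epsilon> K(1) by simp
      from R[THEN spec, THEN spec, THEN mp, OF this]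
      obtain F E where F: "F \<in> \<F>" and good: "\<forall>t\<in>F. ?good \<epsilon> K t (E t)"
        by (elim bexE exE)
      note E = bspec[OF good]
      show "\<exists>F\<in>\<F>. \<forall>t\<in>F. \<exists>r::real. 0 < r \<and>
          U \<inter> (\<Inter>l\<in>{1..N}. {(\<lambda>x. of_real r * f x) | f. f \<in> ?Z \<and> ?T t l f \<in> V l}) \<noteq> {}"
      proof (intro bexI[OF _ F] ballI)
        fix t assume t: "t \<in> F"
        have "t \<in> S" using t F(1) sub by blast
        then interpret t: weighted_translations Y nY \<eta> N "\<alpha> t" "w t" by (rule system)
        let ?E = "E t"
        have adm: "t.admissible \<epsilon> K ?E" unfolding t.admissible_def by (rule E[OF t])
        then have E': "?E \<in> sets borel" "?E \<subseteq> K" "nY (indicator (K - ?E)) < (4 + 2 * real N) * real N * \<epsilon>"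
          by (auto simp: t.admissible_def)
        obtain p where p: "0 < p" "\<forall>s\<in>{1..N}. \<forall>x\<in>?E. p * (\<eta> (\<alpha> t s x) * (1 / w t s x)) \<le> \<tau>"
            "\<forall>l\<in>{1..N}. \<forall>x\<in>?E. \<eta> (inv (\<alpha> t l) x) * w t l (inv (\<alpha> t l) x) \<le> \<tau> * p"
          and d: "\<forall>s\<in>{1..N}. \<forall>l\<in>{1..N}. s \<noteq> l \<longrightarrow> (\<forall>x\<in>?E.
            \<eta> (inv (\<alpha> t l) (\<alpha> t s x)) * (w t l (inv (\<alpha> t l) (\<alpha> t s x)) / w t s x) \<le> \<tau>)"
          by (rule t.admissibleE[OF adm N m_inf m \<epsilon>(1) \<epsilon>_less \<tau>_def])
        define D where "D = B * (M * nY (indicator (K - ?E)) + real N * \<tau> * ?\<kappa>)"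
        have "D \<le> B * (M * ((4 + 2 * real N) * real N * \<epsilon>) + real N * (2 * m * \<epsilon>) * ?\<kappa>)"
          unfolding D_def using E'(3) \<tau>(2) B M(1) \<kappa>
          by (intro mult_left_mono add_mono mult_right_mono) auto
        also have "\<dots> \<le> C * \<epsilon>" using \<epsilon>(1) by (simp add: C_def algebra_simps)
        also note \<open>C * \<epsilon> < r\<close>
        finally have D: "D < r" .
        have zero: "0 \<in> {0..N}" by simp
        note f' = bspec[OF f(1)] f(2)[rule_format] f0[rule_format]
        have sub0: "l \<in> {0..N}" if "l \<in> {1..N}" for l using that by simp
        obtain h where h: "h \<in> ?Z" "?n (\<lambda>x. h x - f 0 x) \<le> D"
          "\<forall>l\<in>{1..N}. ?T t l (\<lambda>x. h x / of_real p) \<in> ?Z"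
          "\<forall>l\<in>{1..N}. ?n (\<lambda>x. ?T t l (\<lambda>x. h x / of_real p) x - f l x) \<le> D"
          by (rule t.common_preimage[where f = "f 0" and g = f, OF compact_mem[OF K(1)] E'(1,2) p(1) B
                less_imp_le[OF \<tau>(1)] M f'(1)[OF zero] f'(2)[OF zero] f'(3)[OF zero] f'(1)[OF sub0] f'(2)[OF sub0] f'(3)[OF sub0]
                p(2,3)[rule_format] d[rule_format] D_def])
        show "\<exists>r::real. 0 < r \<and>
          U \<inter> (\<Inter>l\<in>{1..N}. {(\<lambda>x. of_real r * f x) | f. f \<in> ?Z \<and> ?T t l f \<in> V l}) \<noteq> {}"
        proof (intro exI[of _ p] conjI p(1))
          have "h \<in> U"
            using near[rule_format, OF zero h(1)] h(2) D by (simp add: W_def)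
          moreover have "h \<in> {(\<lambda>x. of_real p * f x) | f. f \<in> ?Z \<and> ?T t l f \<in> V l}" if l: "l \<in> {1..N}" for l
          proof -
            have "?T t l (\<lambda>x. h x / of_real p) \<in> W l"
              using near[rule_format, OF sub0[OF l] bspec[OF h(3) l]] bspec[OF h(4) l] D by simp
            then have "?T t l (\<lambda>x. h x / of_real p) \<in> V l"
              using l by (simp add: W_def)
            moreover have "(\<lambda>x. h x / of_real p) \<in> ?Z"
              using Y.weighted.scale(1)[OF h(1), of "1 / of_real p"] by simp
            moreover have "h = (\<lambda>x. of_real p * (h x / of_real p))" using p(1) by simp
            ultimately show ?thesis
              unfolding mem_Collect_eq by (intro exI[of _ "\<lambda>x. h x / of_real p"] conjI)
          qed
          ultimately show "U \<inter> (\<Inter>l\<in>{1..N}. {(\<lambda>x. of_real p * f x) | f. f \<in> ?Z \<and> ?T t l f \<in> V l}) \<noteq> {}"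
            by blast
        qed
      qed
    qed
  qed
qed

end
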